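(* Let $n\ge 2$ and let $B(0,1)\subset\mathbf{R}^n$ be the open unit ball. There exist a function $u \in W^{1,1}_{\mathrm{loc}}(B(0,1))$ and an elliptic $A \in C(B(0,1); \mathbf{R}^{n \times n})$ such that $u$ is a weak solution of $-\operatorname{div}(A\nabla u)=0$ in $B(0,1)$, $u\in W^{1,p}_{\mathrm{loc}}(B(0,1))$ for every $p\in(1,\infty)$, $Du\in \mathrm{BMO}_{\mathrm{loc}}(B(0,1))$, but $u \notin W^{1,\infty}_{\mathrm{loc}}(B(0,1))$.
   Context: Functions are real-valued. For an open set $\Omega\subset\mathbf{R}^n$, a bounded measurable map $A:\Omega\to\mathbf{R}^{n\times n}$ is called elliptic if $A(x)$ is a symmetric matrix for every $x\in\Omega$ and there exist constants $\lambda,\Lambda>0$ such that $\lambda|\xi|^2\le (A(x)\xi)\cdot\xi\le\Lambda|\xi|^2$ for every $x\in\Omega$ and $\xi\in\mathbf{R}^n$. A function $u\in W^{1,1}_{\mathrm{loc}}(\Omega)$ is a weak solution of $-\operatorname{div}(A\nabla u)=0$ in $\Omega$ if $\int_\Omega (A\nabla u)\cdot\nabla\varphi=0$ for every $\varphi\in C^1_c(\Omega)$. $Du$ denotes the weak gradient of $u$. For an open ball $U$, an integrable (vector-valued) function $f$ on $U$ belongs to $\mathrm{BMO}(U)$ if $\sup_{B\subset U}\frac{1}{|B|}\int_B |f-f_B|<\infty$, the supremum being over all balls $B\subset U$, with $f_B=\frac1{|B|}\int_B f$; $f\in\mathrm{BMO}_{\mathrm{loc}}(\Omega)$ means $f\in\mathrm{BMO}(U)$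 for every open ball $U$ whose closure is a compact subset of $\Omega$. *)

theory Defs
  imports "HOL-Analysis.Analysis"
begin

definition compactly_contained :: "'a::topological_space set \<Rightarrow> 'a set \<Rightarrow> bool" where
  "compactly_contained U \<Omega> \<longleftrightarrow> compact (closure U) \<and> closure U \<subseteq> \<Omega>"

definition gradient :: "('a::real_inner \<Rightarrow> real) \<Rightarrow> 'a \<Rightarrow> 'a" where
  "gradient \<phi> x = (THE D. GDERIV \<phi> x :> D)"

text \<open>A compactly supported function on \<open>\<Omega>\<close> is represented by its extension by zero to the
  whole space.\<close>

definition C1_c :: "'a::real_inner set \<Rightarrow> ('a \<Rightarrow> real) set" where
  "C1_c \<Omega> = {\<phi>. (\<forall>x. \<exists>D. GDERIV \<phi> x :> D) \<and> continuous_on UNIV (gradient \<phi>) \<and>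
     compactly_contained {x. \<phi> x \<noteq> 0} \<Omega>}"

text \<open>Elements of Lebesgue and Sobolev spaces are represented by functions on the whole space;
  their values outside \<open>\<Omega>\<close> are irrelevant.\<close>

definition Lp :: "ereal \<Rightarrow> 'a::euclidean_space set \<Rightarrow> ('a \<Rightarrow> 'b::euclidean_space) set" where
  "Lp p \<Omega> = {f. f \<in> borel_measurable (lebesgue_on \<Omega>) \<and>
     (if p = \<infinity> then \<exists>M. AE x in lebesgue_on \<Omega>. norm (f x) \<le> M
      else integrable (lebesgue_on \<Omega>) (\<lambda>x. norm (f x) powr real_of_ereal p))}"

definition locally_integrable :: "'a::euclidean_space set \<Rightarrow> ('a \<Rightarrow> 'b::euclidean_space) \<Rightarrow> bool" where
  "locally_integrable \<Omega> f \<longleftrightarrow> (\<forall>K. compact K \<and> K \<subseteq> \<Omega> \<longrightarrow> integrable (lebesgue_on K) f)"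

definition has_weak_gradient ::
    "'a::euclidean_space set \<Rightarrow> ('a \<Rightarrow> real) \<Rightarrow> ('a \<Rightarrow> 'a) \<Rightarrow> bool" where
  "has_weak_gradient \<Omega> u G \<longleftrightarrow> locally_integrable \<Omega> u \<and> locally_integrable \<Omega> G \<and>
     (\<forall>\<phi>\<in>C1_c \<Omega>. integral\<^sup>L (lebesgue_on \<Omega>) (\<lambda>x. u x *\<^sub>R gradient \<phi> x)
                 = - integral\<^sup>L (lebesgue_on \<Omega>) (\<lambda>x. \<phi> x *\<^sub>R G x))"

definition W1p :: "ereal \<Rightarrow> 'a::euclidean_space set \<Rightarrow> ('a \<Rightarrow> real) set" where
  "W1p p \<Omega> = {u. u \<in> Lp p \<Omega> \<and> (\<exists>G. has_weak_gradient \<Omega> u G \<and> G \<in> Lp p \<Omega>)}"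

definition W1p_loc :: "ereal \<Rightarrow> 'a::euclidean_space set \<Rightarrow> ('a \<Rightarrow> real) set" where
  "W1p_loc p \<Omega> = {u. \<forall>U. open U \<and> compactly_contained U \<Omega> \<longrightarrow> u \<in> W1p p U}"

definition elliptic :: "(real ^ 'n) set \<Rightarrow> (real ^ 'n \<Rightarrow> real ^ 'n ^ 'n) \<Rightarrow> bool" where
  "elliptic \<Omega> A \<longleftrightarrow>
     A \<in> borel_measurable (lebesgue_on \<Omega>) \<and> bounded (A ` \<Omega>) \<and>
     (\<forall>x\<in>\<Omega>. transpose (A x) = A x) \<and>
     (\<exists>l>0. \<exists>L>0. \<forall>x\<in>\<Omega>. \<forall>\<xi>.
        l * (norm \<xi>)\<^sup>2 \<le> (A x *v \<xi>) \<bullet> \<xi> \<and> (A x *v \<xi>) \<bullet> \<xi> \<le> L * (norm \<xi>)\<^sup>2)"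

text \<open>The weak gradient is unique up to null sets, so the choice of \<open>G\<close> does not matter.\<close>

definition weak_solution ::
    "(real ^ 'n) set \<Rightarrow> (real ^ 'n \<Rightarrow> real ^ 'n ^ 'n) \<Rightarrow> (real ^ 'n \<Rightarrow> real) \<Rightarrow> bool" where
  "weak_solution \<Omega> A u \<longleftrightarrow> u \<in> W1p_loc 1 \<Omega> \<and>
     (\<exists>G. has_weak_gradient \<Omega> u G \<and>
       (\<forall>\<phi>\<in>C1_c \<Omega>. integral\<^sup>L (lebesgue_on \<Omega>) (\<lambda>x. (A x *v G x) \<bullet> gradient \<phi> x) = 0))"

definition average :: "'a::euclidean_space set \<Rightarrow> ('a \<Rightarrow> 'b::euclidean_space) \<Rightarrow> 'b" where
  "average B f = (1 / measure lebesgue B) *\<^sub>R integral\<^sup>L (lebesgue_on B) f"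

definition BMO :: "'a::euclidean_space set \<Rightarrow> ('a \<Rightarrow> 'b::euclidean_space) set" where
  "BMO U = {f. integrable (lebesgue_on U) f \<and>
     bdd_above {average (ball z s) (\<lambda>x. norm (f x - average (ball z s) f)) | z s.
       s > 0 \<and> ball z s \<subseteq> U}}"

definition BMO_loc :: "'a::euclidean_space set \<Rightarrow> ('a \<Rightarrow> 'b::euclidean_space) set" where
  "BMO_loc \<Omega> = {f. \<forall>c r. r > 0 \<and> compactly_contained (ball c r) \<Omega> \<longrightarrow> f \<in> BMO (ball c r)}"

end

theory Submission
  imports Defs
begin

text \<open>
  The solution is \<open>u(x) = (x \<bullet> e) * v(|x|)\<close> with \<open>v(r) = 4 - ln r\<close> and \<open>e\<close> a unit coordinate
  vector. For a coefficient matrix that is the identity in the radial direction and multiplies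
  tangential vectors by \<open>1 - c(r)\<close>, the equation for a function of this shape is an ordinary differential
  equation in which \<open>v\<close> may be prescribed and \<open>c\<close> solved for. Since \<open>r v' = -1\<close> and \<open>r\<^sup>2 v'' = 1\<close>, the
  result is \<open>c = \<kappa> / v\<close> with \<open>\<kappa> = n / (n - 1)\<close>. As \<open>v\<close> tends to infinity at the
  origin, \<open>c\<close> tends to \<open>0\<close>, so the matrix extends continuously by the identity; as \<open>v > 4\<close> and
  \<open>\<kappa> \<le> 2\<close> in the unit ball, \<open>c \<le> 1/2\<close> and the matrix is elliptic.

  The gradient \<open>v e - ((x \<bullet> e) / |x|\<^sup>2) x\<close> is a logarithm plus a bounded field. Hence it is in every
  \<open>L\<^sup>p\<close> with finite \<open>p\<close> and has bounded mean oscillation (\<open>log_sol_grad_BMO\<close>), while its component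
  along \<open>e\<close> tends to infinity at the origin. The latter contradicts a bounded weak gradient when tested
  with nonnegative bumps concentrating at the origin (\<open>log_sol_not_W1_infinity\<close>).

  Away from the origin the equation is a pointwise computation: the flux \<open>A \<nabla>u\<close> is
  \<open>(v - \<kappa>) e + (\<kappa> - 1) ((x \<bullet> e) / |x|\<^sup>2) x\<close>, whose divergence vanishes (\<open>div_flux_eq_0\<close>). That
  the origin carries no distributional mass is the content of
  \<open>has_weak_gradient_removable_singularity\<close>: a continuous pointwise gradient off the origin is a weak gradient as
  soon as it, the function, and the function divided by \<open>|x|\<close> are integrable. This lemma is applied to
  \<open>u\<close> and to every component of the flux. All these functions are bounded by multiples of
  \<open>(5 - ln |x|) / |x|\<close>, which is integrable in dimension at least two by summing over dyadic balls.
\<close>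

section \<open>Integrability of powers of the norm\<close>

lemma dyadic_scale_exists:
  fixes t :: real
  assumes "1 < t"
  obtains k :: nat where "2 ^ k \<le> t" "t \<le> 2 ^ Suc k"
proof -
  define k where "k = nat \<lfloor>log 2 t\<rfloor>"
  have "0 \<le> log 2 t" using assms by simp
  then have "real k \<le> log 2 t" "log 2 t \<le> real (Suc k)"
    unfolding k_def by linarith+
  then have "2 powr real k \<le> t" "t \<le> 2 powr real (Suc k)"
    using assms by (simp_all add: le_log_iff log_le_iff del: of_nat_Suc)
  then show ?thesis using that by (simp add: powr_realpow del: of_nat_Suc)
qed

lemma ennreal_le_suminf: "f k \<le> (\<Sum>k. f k)" for f :: "nat \<Rightarrow> ennreal"
  using sum_le_suminf[OF summableI, of "{k}" f] by simp

text \<open>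
  On the shell where \<open>|x|\<close> is between \<open>R / 2^(k+1)\<close> and \<open>R / 2^k\<close> the integrand is at most
  \<open>2^(s(k+1))\<close>, and the ball of radius \<open>R / 2^k\<close> has measure \<open>2^(-kn)\<close> times that of the whole ball.
  The resulting geometric series has ratio \<open>2^(s-n) < 1\<close>. The bound scales with the measure of the ball,
  which is what the mean oscillation estimate uses.
\<close>
lemma nn_integral_norm_powr_ball_le:
  fixes s R :: real
  assumes s: "0 \<le> s" "s < DIM('a::euclidean_space)" and R: "0 < R"
  shows "(\<integral>\<^sup>+x. ennreal ((R / norm x) powr s) * indicator (ball (0::'a) R) x \<partial>lebesgue)
           \<le> ennreal (2 powr s / (1 - 2 powr (s - DIM('a))) * measure lebesgue (ball (0::'a) R))"
proof -
  define n where "n = DIM('a)"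
  define V where "V = measure lebesgue (ball (0::'a) R)"
  define q where "q = 2 powr (s - n)"
  have q: "0 < q" "q < 1" using s by (simp_all add: q_def n_def powr_less_one)
  have V: "0 \<le> V" by (simp add: V_def)
  have dyadic: "ennreal ((R / norm x) powr s) * indicator (ball 0 R) x
      \<le> (\<Sum>k. ennreal (2 powr (s * Suc k)) * indicator (cball 0 (R / 2 ^ k)) x)" for x :: 'a
  proof (cases "x \<in> ball 0 R \<and> x \<noteq> 0")
    case True
    then have "1 < R / norm x" by simp
    then obtain k where k: "2 ^ k \<le> R / norm x" "R / norm x \<le> 2 ^ Suc k"
      by (rule dyadic_scale_exists)
    have "x \<in> cball 0 (R / 2 ^ k)" using k(1) True R by (simp add: field_simps)
    moreover have "(R / norm x) powr s \<le> (2 ^ Suc k) powr s"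
      using k s True R by (intro powr_mono2) auto
    then have "(R / norm x) powr s \<le> 2 powr (s * Suc k)"
      by (simp add: powr_realpow[symmetric] powr_powr mult.commute del: power_Suc of_nat_Suc)
    ultimately have "ennreal ((R / norm x) powr s) * indicator (ball 0 R) x
        \<le> ennreal (2 powr (s * Suc k)) * indicator (cball 0 (R / 2 ^ k)) x"
      using True by (simp add: ennreal_leI del: of_nat_Suc)
    also have "\<dots> \<le> (\<Sum>k. ennreal (2 powr (s * Suc k)) * indicator (cball 0 (R / 2 ^ k)) x)"
      by (rule ennreal_le_suminf)
    finally show ?thesis .
  qed (auto simp: indicator_def)
  have ball_measure: "emeasure lebesgue (cball (0::'a) (R / 2 ^ k)) = ennreal (V / 2 ^ (k * n))" for k
  proof -
    have "emeasure lebesgue (cball (0::'a) (R / 2 ^ k)) = ennreal (measure lebesgue (cball (0::'a) (R / 2 ^ k)))"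
      by (simp add: emeasure_eq_ennreal_measure emeasure_cball R less_imp_le)
    also have "measure lebesgue (cball (0::'a) (R / 2 ^ k)) = V / 2 ^ (k * n)"
      using R by (simp add: V_def content_ball content_cball n_def power_divide power_mult)
    finally show ?thesis .
  qed
  have summand: "2 powr (s * Suc k) * (V / 2 ^ (k * n)) = 2 powr s * V * q ^ k" for k
  proof -
    have "2 powr (s * Suc k) = 2 powr s * (2 powr s) ^ k"
      by (simp add: powr_add powr_powr powr_realpow[symmetric] distrib_left)
    moreover have "q ^ k = (2 powr s) ^ k / 2 ^ (k * n)"
      by (simp add: q_def powr_diff power_divide powr_realpow power_mult[symmetric] mult.commute)
    ultimately show ?thesis by simp
  qed
  have "(\<integral>\<^sup>+x. ennreal ((R / norm x) powr s) * indicator (ball (0::'a) R) x \<partial>lebesgue)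
      \<le> (\<integral>\<^sup>+x. (\<Sum>k. ennreal (2 powr (s * Suc k)) * indicator (cball (0::'a) (R / 2 ^ k)) x) \<partial>lebesgue)"
    by (intro nn_integral_mono dyadic)
  also have "\<dots> = (\<Sum>k. \<integral>\<^sup>+x. ennreal (2 powr (s * Suc k)) * indicator (cball (0::'a) (R / 2 ^ k)) x \<partial>lebesgue)"
    by (intro nn_integral_suminf borel_measurable_times_ennreal borel_measurable_const
        borel_measurable_indicator) simp
  also have "\<dots> = (\<Sum>k. ennreal (2 powr s * V * q ^ k))"
  proof (rule suminf_cong)
    fix k
    have "(\<integral>\<^sup>+x. ennreal (2 powr (s * Suc k)) * indicator (cball (0::'a) (R / 2 ^ k)) x \<partial>lebesgue)
        = ennreal (2 powr (s * Suc k)) * ennreal (V / 2 ^ (k * n))"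
      by (subst nn_integral_cmult_indicator) (simp_all only: ball_measure, simp)
    also have "\<dots> = ennreal (2 powr s * V * q ^ k)"
      using V by (subst ennreal_mult[symmetric]) (simp_all only: summand, simp_all)
    finally show "(\<integral>\<^sup>+x. ennreal (2 powr (s * Suc k)) * indicator (cball (0::'a) (R / 2 ^ k)) x \<partial>lebesgue)
        = ennreal (2 powr s * V * q ^ k)" .
  qed
  also have "\<dots> = ennreal (\<Sum>k. 2 powr s * V * q ^ k)"
    using q V by (intro suminf_ennreal2) (auto intro!: summable_mult summable_geometric)
  also have "(\<Sum>k. 2 powr s * V * q ^ k) = 2 powr s * V * (1 / (1 - q))"
    using q by (subst suminf_mult) (auto simp: suminf_geometric summable_geometric)
  finally show ?thesis by (simp add: V_def q_def n_def)
qed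

lemma AE_nonzero_lebesgue_on: "S \<in> sets lebesgue \<Longrightarrow> AE x in lebesgue_on (S::'a::euclidean_space set). x \<noteq> 0"
  apply (simp add: AE_restrict_space_iff)
  using AE_completion[OF AE_lborel_singleton[of "0::'a"]] by (auto elim: AE_mp)

lemma norm_powr_ball:
  fixes s R :: real
  assumes s: "0 \<le> s" "s < DIM('a::euclidean_space)" and R: "0 < R"
  shows integrable_norm_powr_ball: "integrable (lebesgue_on (ball (0::'a) R)) (\<lambda>x. (R / norm x) powr s)"
    and integral_norm_powr_ball_le: "(\<integral>x. (R / norm x) powr s \<partial>lebesgue_on (ball (0::'a) R))
           \<le> 2 powr s / (1 - 2 powr (s - DIM('a))) * measure lebesgue (ball (0::'a) R)"
proof -
  have meas: "(\<lambda>x::'a. (R / norm x) powr s) \<in> borel_measurable (lebesgue_on (ball 0 R))"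
    by (intro measurable_restrict_space1 measurable_completion) measurable
  have C: "0 \<le> 2 powr s / (1 - 2 powr (s - DIM('a))) * measure lebesgue (ball (0::'a) R)"
    using s by (intro mult_nonneg_nonneg divide_nonneg_nonneg)
      (auto simp: less_imp_le powr_less_one)
  have bound: "(\<integral>\<^sup>+x. ennreal ((R / norm x) powr s) \<partial>lebesgue_on (ball (0::'a) R))
      \<le> ennreal (2 powr s / (1 - 2 powr (s - DIM('a))) * measure lebesgue (ball (0::'a) R))"
    using nn_integral_norm_powr_ball_le[OF assms] by (simp add: nn_integral_restrict_space)
  show "integrable (lebesgue_on (ball (0::'a) R)) (\<lambda>x. (R / norm x) powr s)"
    using bound by (intro integrableI_bounded meas)
      (auto simp: top_unique intro: le_less_trans)
  show "(\<integral>x. (R / norm x) powr s \<partial>lebesgue_on (ball (0::'a) R))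
           \<le> 2 powr s / (1 - 2 powr (s - DIM('a))) * measure lebesgue (ball (0::'a) R)"
    using bound C by (subst integral_eq_nn_integral[OF meas])
      (auto intro: enn2real_leI)
qed

section \<open>Test functions and the vanishing integral of a gradient\<close>

lemma gderiv_unique:
  assumes "GDERIV f x :> D" "GDERIV f x :> E"
  shows "D = E"
proof -
  have "(\<lambda>h. h \<bullet> D) = (\<lambda>h. h \<bullet> E)"
    using assms has_derivative_unique unfolding gderiv_def by blast
  then have "(D - E) \<bullet> D = (D - E) \<bullet> E" by (rule fun_cong)
  then have "(D - E) \<bullet> (D - E) = 0" by (simp only: inner_diff_right)
  then show ?thesis by simp
qed

lemma gradient_eqI: "GDERIV f x :> D \<Longrightarrow> gradient f x = D"
  unfolding gradient_def by (rule the_equality) (auto intro: gderiv_unique)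

lemma C1_c_gderiv:
  assumes "f \<in> C1_c \<Omega>"
  shows "GDERIV f x :> gradient f x"
proof -
  obtain D where "GDERIV f x :> D" using assms unfolding C1_c_def by blast
  then show ?thesis using gradient_eqI by metis
qed

lemma C1_c_continuous_gradient: "f \<in> C1_c \<Omega> \<Longrightarrow> continuous_on UNIV (gradient f)"
  by (simp add: C1_c_def)

lemma C1_c_continuous: "f \<in> C1_c \<Omega> \<Longrightarrow> continuous_on UNIV f"
  using C1_c_gderiv[of f \<Omega>, unfolded gderiv_def]
  by (intro continuous_at_imp_continuous_on ballI) (rule has_derivative_continuous)

lemma C1_c_compact_support:
  assumes "f \<in> C1_c \<Omega>"
  shows "compact (closure {x. f x \<noteq> 0})" "closure {x. f x \<noteq> 0} \<subseteq> \<Omega>"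
  using assms by (auto simp: C1_c_def compactly_contained_def)

lemma C1_c_eq_0: "x \<notin> closure {x. f x \<noteq> 0} \<Longrightarrow> f x = 0"
  using closure_subset[of "{x. f x \<noteq> 0}"] by auto

lemma gderiv_eventually_cong:
  assumes "GDERIV f x :> D" "\<forall>\<^sub>F y in nhds x. f y = g y"
  shows "GDERIV g x :> D"
  using assms has_derivative_transform_eventually[of f _ x UNIV g]
    eventually_nhds_conv_at[of "\<lambda>y. f y = g y" x]
  unfolding gderiv_def by simp

lemma eventually_notin_closure: "x \<notin> closure S \<Longrightarrow> \<forall>\<^sub>F y in nhds x. y \<notin> closure S"
  using eventually_nhds_in_open[of "- closure S" x] by (simp add: open_Compl)

lemma C1_c_gradient_eq_0:
  assumes "x \<notin> closure {x. f x \<noteq> 0}"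
  shows "gradient f x = 0"
proof -
  have "\<forall>\<^sub>F y in nhds x. (\<lambda>_. 0) y = f y"
    using eventually_notin_closure[OF assms] by eventually_elim (metis C1_c_eq_0)
  then have "GDERIV f x :> 0" using gderiv_eventually_cong[OF GDERIV_const] by blast
  then show ?thesis by (rule gradient_eqI)
qed

lemma C1_c_bounded:
  fixes f :: "'a::euclidean_space \<Rightarrow> real"
  assumes "f \<in> C1_c \<Omega>"
  obtains M where "0 \<le> M" "\<And>x. \<bar>f x\<bar> \<le> M" "\<And>x. norm (gradient f x) \<le> M"
proof -
  define S where "S = closure {x. f x \<noteq> 0}"
  have S: "compact S" using C1_c_compact_support(1)[OF assms] by (simp add: S_def)
  have "compact (f ` S)" "compact (gradient f ` S)"
    using S C1_c_continuous[OF assms] C1_c_continuous_gradient[OF assms]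
    by (auto intro!: compact_continuous_image intro: continuous_on_subset)
  then have "bounded (f ` S)" "bounded (gradient f ` S)" by (simp_all add: compact_imp_bounded)
  then obtain a b where ab: "\<And>x. x \<in> S \<Longrightarrow> \<bar>f x\<bar> \<le> a" "\<And>x. x \<in> S \<Longrightarrow> norm (gradient f x) \<le> b"
    unfolding bounded_iff ball_simps real_norm_def by blast
  show ?thesis
  proof (rule that[of "max 0 (max a b)"])
    show "\<bar>f x\<bar> \<le> max 0 (max a b)" for x
      using ab(1)[of x] C1_c_eq_0[of x f] by (cases "x \<in> S") (auto simp: S_def)
    show "norm (gradient f x) \<le> max 0 (max a b)" for x
      using ab(2)[of x] C1_c_gradient_eq_0[of x f] by (cases "x \<in> S") (auto simp: S_def)
  qed simp
qed

text \<open>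
  Dominates the difference quotients in the next integral computation.
\<close>
lemma C1_c_Lipschitz:
  fixes f :: "'a::euclidean_space \<Rightarrow> real"
  assumes "f \<in> C1_c \<Omega>" and M: "\<And>x. norm (gradient f x) \<le> M"
  shows "\<bar>f y - f x\<bar> \<le> M * norm (y - x)"
proof -
  have "norm (f y - f x) \<le> M * norm (y - x)"
  proof (rule differentiable_bound[of UNIV f "\<lambda>x h. h \<bullet> gradient f x"])
    show "onorm (\<lambda>h. h \<bullet> gradient f z) \<le> M" for z
    proof (rule onorm_le)
      show "norm (h \<bullet> gradient f z) \<le> M * norm h" for h
        using Cauchy_Schwarz_ineq2[of h "gradient f z"] mult_right_mono[OF M[of z], of "norm h"]
        by (simp add: mult.commute)
    qed
  qed (use C1_c_gderiv[OF assms(1)] in \<open>auto simp: gderiv_def intro: has_derivative_at_withinI\<close>)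
  then show ?thesis by simp
qed

lemma integral_translate_lborel:
  fixes f :: "'a::euclidean_space \<Rightarrow> real"
  assumes "integrable lborel f"
  shows "integrable lborel (\<lambda>x. f (c + x))" "(\<integral>x. f (c + x) \<partial>lborel) = (\<integral>x. f x \<partial>lborel)"
proof -
  have f: "f \<in> borel_measurable borel" using borel_measurable_integrable[OF assms] by simp
  show "integrable lborel (\<lambda>x. f (c + x))"
    using assms f by (subst (asm) lborel_distr_plus[of c, symmetric]) (simp add: integrable_distr_eq)
  show "(\<integral>x. f (c + x) \<partial>lborel) = (\<integral>x. f x \<partial>lborel)"
    using f by (subst (2) lborel_distr_plus[of c, symmetric]) (simp add: integral_distr)
qed

text \<open>
  The divergence theorem for compactly supported functions needs no boundary: the difference quotients
  in direction \<open>b\<close> have integral zero because Lebesgue measure is translation invariant, and they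
  converge boundedly, with supports in a common ball, to the directional derivative.
\<close>
lemma integral_partial_derivative_eq_0:
  fixes f :: "'a::euclidean_space \<Rightarrow> real"
  assumes f: "f \<in> C1_c UNIV"
  shows "(\<integral>x. gradient f x \<bullet> b \<partial>lborel) = 0"
proof -
  define S where "S = closure {x. f x \<noteq> 0}"
  define t where "t k = inverse (real (Suc k))" for k
  define Q where "Q k x = (f (t k *\<^sub>R b + x) - f x) / t k" for k x
  obtain M where M: "0 \<le> M" "\<And>x. \<bar>f x\<bar> \<le> M" "\<And>x. norm (gradient f x) \<le> M"
    using C1_c_bounded[OF f] by blast
  have "bounded S" using C1_c_compact_support(1)[OF f] unfolding S_def by (rule compact_imp_bounded)
  then obtain R where R: "\<And>x. x \<in> S \<Longrightarrow> norm x \<le> R" by (auto simp: bounded_iff)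
  define K where "K = cball (0::'a) (R + norm b)"
  have t: "0 < t k" "t k \<le> 1" for k by (simp_all add: t_def field_simps)
  have tl: "t \<longlonglongrightarrow> 0" unfolding t_def by (rule LIMSEQ_inverse_real_of_nat)
  have meas[measurable]: "f \<in> borel_measurable borel" "gradient f \<in> borel_measurable borel"
    using C1_c_continuous[OF f] C1_c_continuous_gradient[OF f] by (auto intro: borel_measurable_continuous_onI)
  have K: "integrable lborel (\<lambda>x. C * indicator K x)" for C :: real
    unfolding K_def by (intro integrable_mult_right integrable_real_indicator) (use emeasure_lborel_cball_finite[of "0::'a"] in auto)
  have supp: "norm x \<le> R" if "f x \<noteq> 0" for x
    using R[of x] that closure_subset[of "{x. f x \<noteq> 0}"] by (auto simp: S_def)
  have suppK: "f x = 0" if "x \<notin> K" for x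
  proof (rule ccontr)
    assume "f x \<noteq> 0"
    then have "norm x \<le> R" by (rule supp)
    then have "x \<in> K" using norm_ge_zero[of b] by (simp add: K_def del: norm_ge_zero)
    with that show False by simp
  qed
  have int: "integrable lborel f"
  proof (rule Bochner_Integration.integrable_bound[OF K[of M]])
    have "norm (f x) \<le> norm (M * indicator K x)" for x
      using M(1) M(2)[of x] suppK[of x] by (cases "x \<in> K") simp_all
    then show "AE x in lborel. norm (f x) \<le> norm (M * indicator K x)" by simp
  qed simp
  have "(\<lambda>k. \<integral>x. Q k x \<partial>lborel) \<longlonglongrightarrow> (\<integral>x. gradient f x \<bullet> b \<partial>lborel)"
  proof (rule integral_dominated_convergence)
    show "integrable lborel (\<lambda>x. (M * norm b) * indicator K x)" by (rule K)
    show "AE x in lborel. norm (Q k x) \<le> M * norm b * indicator K x" for k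
    proof (rule AE_I2)
      fix x
      show "norm (Q k x) \<le> M * norm b * indicator K x"
      proof (cases "x \<in> K")
        case True
        then show ?thesis
          using C1_c_Lipschitz[OF f M(3), of "t k *\<^sub>R b + x" x] t[of k]
          by (simp add: Q_def divide_simps mult_ac)
      next
        case False
        have "f (t k *\<^sub>R b + x) = 0"
        proof (rule ccontr)
          assume "f (t k *\<^sub>R b + x) \<noteq> 0"
        then have "norm (t k *\<^sub>R b + x) \<le> R" by (rule supp)
          moreover have "norm x \<le> norm (t k *\<^sub>R b + x) + norm (t k *\<^sub>R b)"
            using norm_triangle_ineq4[of "t k *\<^sub>R b + x" "t k *\<^sub>R b"] by simp
          moreover have "norm (t k *\<^sub>R b) \<le> norm b"
            using t[of k] by (simp add: mult_left_le_one_le)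
          ultimately have "x \<in> K" by (simp add: K_def)
          with False show False by simp
        qed
        then show ?thesis using False suppK[of x] by (simp add: Q_def)
      qed
    qed
    show "AE x in lborel. (\<lambda>k. Q k x) \<longlonglongrightarrow> gradient f x \<bullet> b"
    proof (rule AE_I2)
      fix x
      have "((\<lambda>s. f (s *\<^sub>R b + x)) has_derivative (\<lambda>h. (h *\<^sub>R b) \<bullet> gradient f x)) (at 0)"
        by (rule has_derivative_compose[where g = f, of "\<lambda>s. s *\<^sub>R b + x"])
          (use C1_c_gderiv[OF f, of x] in \<open>auto simp: gderiv_def intro!: derivative_eq_intros\<close>)
      then have "((\<lambda>s. f (s *\<^sub>R b + x)) has_field_derivative gradient f x \<bullet> b) (at 0)"
        by (simp add: has_field_derivative_def inner_commute mult_commute_abs)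
      then have "(\<lambda>s. (f (s *\<^sub>R b + x) - f x) / s) \<midarrow>0\<rightarrow> gradient f x \<bullet> b"
        by (simp add: DERIV_def)
      moreover have "filterlim t (at 0) sequentially"
        using tl t(1) by (auto simp: filterlim_at intro!: always_eventually less_imp_neq[THEN not_sym])
      ultimately show "(\<lambda>k. Q k x) \<longlonglongrightarrow> gradient f x \<bullet> b"
        unfolding Q_def by (rule filterlim_compose)
    qed
  qed (unfold Q_def, measurable)
  moreover have "(\<integral>x. Q k x \<partial>lborel) = 0" for k
    using integral_translate_lborel[OF int, of "t k *\<^sub>R b"] int
    by (simp add: Q_def Bochner_Integration.integral_diff)
  ultimately show ?thesis by (simp add: LIMSEQ_const_iff)
qed

lemma integrable_compactly_supported_continuous:
  fixes f :: "'a::euclidean_space \<Rightarrow> 'b::euclidean_space"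
  assumes "continuous_on UNIV f" "compact S" "\<And>x. x \<notin> S \<Longrightarrow> f x = 0"
  shows "integrable lborel f"
proof -
  have "set_integrable lborel S f"
    unfolding set_integrable_def
    using assms by (intro borel_integrable_compact) (auto intro: continuous_on_subset)
  moreover have "(\<lambda>x. indicator S x *\<^sub>R f x) = f"
    using assms(3) by (auto simp: indicator_def)
  ultimately show ?thesis by (simp add: set_integrable_def)
qed

lemma integral_gradient_eq_0:
  fixes f :: "'a::euclidean_space \<Rightarrow> real"
  assumes f: "f \<in> C1_c UNIV"
  shows "integral\<^sup>L lborel (gradient f) = 0"
proof (rule euclidean_eqI)
  fix b :: 'a
  have "integrable lborel (gradient f)"
    using C1_c_continuous_gradient[OF f] C1_c_compact_support(1)[OF f] C1_c_gradient_eq_0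
    by (rule integrable_compactly_supported_continuous)
  then show "integral\<^sup>L lborel (gradient f) \<bullet> b = 0 \<bullet> b"
    using integral_partial_derivative_eq_0[OF f, of b] by (simp add: integral_inner_left)
qed

section \<open>Weak gradients across a removable point singularity\<close>

text \<open>
  This once differentiable truncation builds both the cutoffs at the origin and the bump
  functions used as test functions.
\<close>
lemma DERIV_max_0_squared:
  "((\<lambda>t::real. (max 0 t)\<^sup>2) has_real_derivative 2 * max 0 t) (at t)"
proof (cases t "0 :: real" rule: linorder_cases)
  case less
  have "((\<lambda>t::real. 0) has_real_derivative 2 * max 0 t) (at t)" using less by simp
  then show ?thesis
    by (rule DERIV_cong_ev[THEN iffD1, rotated 3])
      (use less eventually_nhds_in_open[of "{..<0}" t] in \<open>auto elim!: eventually_mono\<close>)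
next
  case equal
  then show ?thesis
    by (subst CARAT_DERIV, intro exI[of _ "max 0"]) (auto simp: max_def power2_eq_square intro!: continuous_intros)
next
  case greater
  have "((\<lambda>t::real. t\<^sup>2) has_real_derivative 2 * max 0 t) (at t)"
    using greater by (auto intro!: derivative_eq_intros)
  then show ?thesis
    by (rule DERIV_cong_ev[THEN iffD1, rotated 3])
      (use greater eventually_nhds_in_open[of "{0<..}" t] in \<open>auto elim!: eventually_mono\<close>)
qed

lemma C1_cutoff_exists:
  obtains \<theta> \<theta>' :: "real \<Rightarrow> real"
  where "\<And>t. (\<theta> has_real_derivative \<theta>' t) (at t)" "continuous_on UNIV \<theta>'"
    "\<And>t. t \<le> 1 \<Longrightarrow> \<theta> t = 0" "\<And>t. 2 \<le> t \<Longrightarrow> \<theta> t = 1" "\<And>t. \<bar>\<theta> t\<bar> \<le> 1"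
    "\<And>t. \<bar>\<theta>' t\<bar> \<le> 4" "\<And>t. t \<le> 1 \<or> 2 \<le> t \<Longrightarrow> \<theta>' t = 0"
proof
  let ?m = "\<lambda>t::real. (max 0 t)\<^sup>2"
  \<comment> \<open>Nesting the truncation turns its one-sided vanishing into a transition from \<open>0\<close> to \<open>1\<close> on \<open>[1, 2]\<close>.\<close>
  define \<theta> where "\<theta> = (\<lambda>t. 1 - ?m (1 - ?m (t - 1)))"
  define \<theta>' where "\<theta>' = (\<lambda>t. 4 * max 0 (1 - ?m (t - 1)) * max 0 (t - 1))"
  show "(\<theta> has_real_derivative \<theta>' t) (at t)" for t
    unfolding \<theta>_def \<theta>'_def
    by (rule derivative_eq_intros DERIV_chain2[OF DERIV_max_0_squared] refl)+ simp
  show "continuous_on UNIV \<theta>'" unfolding \<theta>'_def by (intro continuous_intros)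
  have sq: "1 \<le> ?m (t - 1)" if "2 \<le> t" for t :: real
    using that by simp
  show "\<theta> t = 0" if "t \<le> 1" for t using that by (simp add: \<theta>_def)
  show "\<theta> t = 1" if "2 \<le> t" for t using sq[OF that] by (simp add: \<theta>_def)
  show "\<theta>' t = 0" if "t \<le> 1 \<or> 2 \<le> t" for t using that sq[of t] by (auto simp: \<theta>'_def)
  show "\<bar>\<theta> t\<bar> \<le> 1" for t
  proof -
    have "?m (1 - ?m (t - 1)) \<le> 1" by (rule power_le_one) auto
    moreover have "0 \<le> ?m (1 - ?m (t - 1))" by (rule zero_le_power2)
    ultimately show ?thesis unfolding \<theta>_def by linarith
  qed
  show "\<bar>\<theta>' t\<bar> \<le> 4" for t
  proof (cases "t \<le> 2")
    case True
    have "max 0 (1 - ?m (t - 1)) * max 0 (t - 1) \<le> 1 * 1"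
      using True by (intro mult_mono) auto
    then show ?thesis by (simp add: \<theta>'_def abs_mult)
  next
    case False
    then show ?thesis using sq[of t] by (simp add: \<theta>'_def)
  qed
qed

lemma integrable_lebesgue_on_subset:
  fixes f :: "'a::euclidean_space \<Rightarrow> 'b::euclidean_space"
  assumes "integrable (lebesgue_on S) f" "T \<subseteq> S" "S \<in> sets lebesgue" "T \<in> sets lebesgue"
  shows "integrable (lebesgue_on T) f"
proof -
  have "set_integrable lebesgue S f"
    using assms by (simp add: set_integrable_def integrable_restrict_space)
  then have "set_integrable lebesgue T f" by (rule set_integrable_subset) (use assms in auto)
  then show ?thesis using assms by (simp add: set_integrable_def integrable_restrict_space)
qed

lemma integrable_imp_locally_integrable:
  fixes f :: "'a::euclidean_space \<Rightarrow> 'b::euclidean_space"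
  assumes "integrable (lebesgue_on \<Omega>) f" "open \<Omega>"
  shows "locally_integrable \<Omega> f"
  unfolding locally_integrable_def
proof (intro allI impI, elim conjE)
  fix K :: "'a set" assume "compact K" "K \<subseteq> \<Omega>"
  then show "integrable (lebesgue_on K) f"
    using integrable_lebesgue_on_subset[OF assms(1), of K] \<open>open \<Omega>\<close> by (simp add: borel_compact)
qed

lemma borel_measurable_lebesgue_on:
  "f \<in> borel_measurable borel \<Longrightarrow> f \<in> borel_measurable (lebesgue_on S)"
  by (simp add: measurable_restrict_space1 measurable_completion)

lemma integrable_bounded_scaleR:
  fixes g :: "'a::euclidean_space \<Rightarrow> 'b::euclidean_space"
  assumes "f \<in> borel_measurable M" "\<And>x. \<bar>f x\<bar> \<le> B" "integrable M g"
  shows "integrable M (\<lambda>x. f x *\<^sub>R g x)"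
proof (rule Bochner_Integration.integrable_bound)
  show "integrable M (\<lambda>x. B * norm (g x))" using assms(3) by simp
  show "AE x in M. norm (f x *\<^sub>R g x) \<le> norm (B * norm (g x))"
    using assms(2) by (intro AE_I2) (auto simp: abs_mult intro!: mult_right_mono order_trans[OF _ abs_ge_self])
qed (use assms borel_measurable_integrable in measurable)

lemma integrable_scaleR_bounded:
  fixes g :: "'a::euclidean_space \<Rightarrow> 'b::euclidean_space"
  assumes "g \<in> borel_measurable M" "\<And>x. norm (g x) \<le> B" "integrable M f"
  shows "integrable M (\<lambda>x. f x *\<^sub>R g x)"
proof (rule Bochner_Integration.integrable_bound)
  show "integrable M (\<lambda>x. B * norm (f x))" using assms(3) by simp
  have "B \<ge> 0" using order_trans[OF norm_ge_zero assms(2)] .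
  then show "AE x in M. norm (f x *\<^sub>R g x) \<le> norm (B * norm (f x))"
    using mult_right_mono[OF assms(2) abs_ge_zero] by (intro AE_I2) (simp add: abs_mult mult.commute)
qed (use assms borel_measurable_integrable in measurable)

lemma integral_lebesgue_on_eq_lborel:
  fixes f :: "'a::euclidean_space \<Rightarrow> 'b::euclidean_space"
  assumes "continuous_on UNIV f" "\<And>x. x \<notin> \<Omega> \<Longrightarrow> f x = 0" "\<Omega> \<in> sets lebesgue"
  shows "integral\<^sup>L (lebesgue_on \<Omega>) f = integral\<^sup>L lborel f"
proof -
  have "(\<lambda>x. indicator \<Omega> x *\<^sub>R f x) = f" using assms(2) by (auto simp: indicator_def)
  then show ?thesis
    using assms by (simp add: integral_restrict_space integral_completion borel_measurable_continuous_onI)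
qed

text \<open>
  A factor vanishing near the origin makes the product with a singular \<open>u\<close> an admissible compactly
  supported function on the whole space. Its gradient is given by the product rule on \<open>\<Omega> - {0}\<close> and is zero
  on the open set \<open>Z \<union> - S\<close>, and these two open sets cover everything.
\<close>
lemma C1_c_cutoff_product:
  fixes u \<eta> :: "'a::euclidean_space \<Rightarrow> real" and G D\<eta> :: "'a \<Rightarrow> 'a"
  assumes "open \<Omega>" and \<phi>: "\<phi> \<in> C1_c \<Omega>"
    and u: "\<And>x. x \<in> \<Omega> - {0} \<Longrightarrow> GDERIV u x :> G x" "continuous_on (\<Omega> - {0}) G"
    and \<eta>: "\<And>x. GDERIV \<eta> x :> D\<eta> x" "continuous_on UNIV D\<eta>"
    and Z: "open Z" "0 \<in> Z" "\<And>x. x \<in> Z \<Longrightarrow> \<eta> x = 0"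
  defines "P \<equiv> (\<lambda>x. \<eta> x *\<^sub>R (\<phi> x *\<^sub>R G x + u x *\<^sub>R gradient \<phi> x) + (\<phi> x * u x) *\<^sub>R D\<eta> x)"
  shows "continuous_on UNIV P" "integral\<^sup>L lborel P = 0"
proof -
  define S where "S = closure {x. \<phi> x \<noteq> 0}"
  define p where "p = (\<lambda>x. \<eta> x * (\<phi> x * u x))"
  define N where "N = Z \<union> - S"
  have S: "compact S" "S \<subseteq> \<Omega>"
    unfolding S_def by (rule C1_c_compact_support[OF \<phi>])+
  have N: "open N" unfolding N_def using S Z by (intro open_Un open_Compl compact_imp_closed)
  have D\<eta>0: "D\<eta> x = 0" if "x \<in> Z" for x
  proof (rule gderiv_unique[OF \<eta>(1)], rule gderiv_eventually_cong[OF GDERIV_const[of 0]])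
    show "\<forall>\<^sub>F y in nhds x. 0 = \<eta> y"
      using eventually_nhds_in_open[OF Z(1) that] by eventually_elim (simp add: Z)
  qed
  have cover: "UNIV = N \<union> (\<Omega> - {0})" using S Z by (auto simp: N_def)
  have off: "\<phi> x = 0" "gradient \<phi> x = 0" if "x \<notin> S" for x
    using that C1_c_eq_0[of x \<phi>] C1_c_gradient_eq_0[of x \<phi>] by (simp_all add: S_def)
  have vanish: "p x = 0" "P x = 0" if "x \<in> N" for x
    using that Z(3)[of x] D\<eta>0[of x] off[of x] by (auto simp: N_def p_def P_def)
  have pP: "GDERIV p x :> P x" for x
  proof (cases "x \<in> N")
    case True
    have "GDERIV p x :> 0"
    proof (rule gderiv_eventually_cong[OF GDERIV_const[of 0]])
      show "\<forall>\<^sub>F y in nhds x. 0 = p y"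
        using eventually_nhds_in_open[OF N True] by eventually_elim (simp add: vanish)
    qed
    then show ?thesis using vanish True by simp
  next
    case False
    then have "x \<in> \<Omega> - {0}" using cover by auto
    then have "GDERIV p x :> \<eta> x *\<^sub>R (\<phi> x *\<^sub>R G x + u x *\<^sub>R gradient \<phi> x) + (\<phi> x * u x) *\<^sub>R D\<eta> x"
      unfolding p_def by (intro GDERIV_mult u \<eta> C1_c_gderiv[OF \<phi>])
    then show ?thesis by (simp add: P_def)
  qed
  have cont: "continuous_on UNIV \<eta>"
    using \<eta>(1)[unfolded gderiv_def] by (intro continuous_at_imp_continuous_on ballI) (rule has_derivative_continuous)
  have contu: "continuous_on (\<Omega> - {0}) u"
    using u(1)[unfolded gderiv_def] by (intro continuous_at_imp_continuous_on ballI) (rule has_derivative_continuous)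
  have "continuous_on (\<Omega> - {0}) P"
    unfolding P_def
    by (intro continuous_intros u contu continuous_on_subset[OF cont] continuous_on_subset[OF \<eta>(2)]
        continuous_on_subset[OF C1_c_continuous[OF \<phi>]]
        continuous_on_subset[OF C1_c_continuous_gradient[OF \<phi>]]) auto
  moreover have "continuous_on N P"
    using vanish by (auto intro: continuous_on_eq[OF continuous_on_const])
  ultimately show contP: "continuous_on UNIV P"
    unfolding cover using N \<open>open \<Omega>\<close> by (intro continuous_on_open_Un) auto
  have grad: "gradient p = P" using pP by (auto intro: gradient_eqI)
  have "{x. p x \<noteq> 0} \<subseteq> S" using vanish by (auto simp: N_def)
  then have "closure {x. p x \<noteq> 0} \<subseteq> S" using S by (intro closure_minimal compact_imp_closed)
  then have "compact (closure {x. p x \<noteq> 0})"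
    using S compact_Int_closed[of S "closure {x. p x \<noteq> 0}"] by (simp add: Int_absorb1)
  then have "p \<in> C1_c UNIV"
    using pP contP grad by (auto simp: C1_c_def compactly_contained_def)
  from integral_gradient_eq_0[OF this] show "integral\<^sup>L lborel P = 0" by (simp add: grad)
qed

text \<open>
  Multiplying by cutoffs \<open>\<eta>\<^sub>k(x) = \<theta>((k+1)\<^sup>2 |x|\<^sup>2)\<close> moves all derivatives off the singularity. The error
  term contains \<open>\<nabla>\<eta>\<^sub>k\<close>, which lives where \<open>|x|\<close> is comparable to \<open>1/(k+1)\<close> and is therefore at most
  \<open>16 / |x|\<close> uniformly in \<open>k\<close>. Integrability of \<open>u / |x|\<close> dominates the error, which
  tends to zero pointwise.
\<close>
lemma has_weak_gradient_removable_singularity: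
  fixes u :: "'a::euclidean_space \<Rightarrow> real"
  assumes "open \<Omega>"
    and u: "\<And>x. x \<in> \<Omega> - {0} \<Longrightarrow> GDERIV u x :> G x" "continuous_on (\<Omega> - {0}) G"
    and int: "integrable (lebesgue_on \<Omega>) u" "integrable (lebesgue_on \<Omega>) G"
      "integrable (lebesgue_on \<Omega>) (\<lambda>x. u x / norm x)"
  shows "has_weak_gradient \<Omega> u G"
  unfolding has_weak_gradient_def
proof (intro conjI ballI)
  have \<Omega>: "\<Omega> \<in> sets lebesgue" using \<open>open \<Omega>\<close> by simp
  show "locally_integrable \<Omega> u" "locally_integrable \<Omega> G"
    using int \<open>open \<Omega>\<close> by (auto intro: integrable_imp_locally_integrable)
  fix \<phi> assume \<phi>: "\<phi> \<in> C1_c \<Omega>"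
  obtain M where M: "0 \<le> M" "\<And>x. \<bar>\<phi> x\<bar> \<le> M" "\<And>x. norm (gradient \<phi> x) \<le> M"
    using C1_c_bounded[OF \<phi>] by blast
  obtain \<theta> \<theta>' :: "real \<Rightarrow> real" where \<theta>: "\<And>t. (\<theta> has_real_derivative \<theta>' t) (at t)" "continuous_on UNIV \<theta>'"
    "\<And>t. t \<le> 1 \<Longrightarrow> \<theta> t = 0" "\<And>t. 2 \<le> t \<Longrightarrow> \<theta> t = 1" "\<And>t. \<bar>\<theta> t\<bar> \<le> 1"
    "\<And>t. \<bar>\<theta>' t\<bar> \<le> 4" "\<And>t. t \<le> 1 \<or> 2 \<le> t \<Longrightarrow> \<theta>' t = 0"
    by (rule C1_cutoff_exists) (rule that; assumption)
  define c where "c k = (real (Suc k))\<^sup>2" for k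
  define \<eta> where "\<eta> k x = \<theta> (c k * (x \<bullet> x))" for k and x :: 'a
  define D\<eta> where "D\<eta> k x = (\<theta>' (c k * (x \<bullet> x)) * (2 * c k)) *\<^sub>R x" for k and x :: 'a
  define P where "P k = (\<lambda>x. \<eta> k x *\<^sub>R (\<phi> x *\<^sub>R G x + u x *\<^sub>R gradient \<phi> x) + (\<phi> x * u x) *\<^sub>R D\<eta> k x)" for k
  have c: "0 < c k" for k by (simp add: c_def)
  have P: "continuous_on UNIV (P k)" "integral\<^sup>L lborel (P k) = 0" for k
  proof -
    have 1: "GDERIV (\<eta> k) x :> D\<eta> k x" for x
    proof -
      have "GDERIV (\<lambda>x::'a. c k * (x \<bullet> x)) x :> (2 * c k) *\<^sub>R x"
        unfolding gderiv_def by (auto intro!: derivative_eq_intros simp: inner_commute algebra_simps)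
      from GDERIV_DERIV_compose[OF this \<theta>(1)] show ?thesis
        by (simp add: \<eta>_def[abs_def] D\<eta>_def)
    qed
    have 2: "continuous_on UNIV (D\<eta> k)"
      unfolding D\<eta>_def[abs_def] by (intro continuous_intros continuous_on_compose2[OF \<theta>(2)]) auto
    have 3: "open {x::'a. c k * (x \<bullet> x) < 1}" by (intro open_Collect_less continuous_intros)
    show "continuous_on UNIV (P k)" "integral\<^sup>L lborel (P k) = 0"
      unfolding P_def using C1_c_cutoff_product[OF \<open>open \<Omega>\<close> \<phi> u 1 2 3] \<theta>(3)
      by (simp_all add: \<eta>_def)
  qed
  \<comment> \<open>Where the derivative of the cutoff is nonzero, \<open>c k * |x|\<^sup>2 < 2\<close>, so \<open>4 * 2 * c k * |x| \<le> 16 / |x|\<close>.\<close>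
  have D\<eta>_bound: "norm (D\<eta> k x) \<le> 16 / norm x" for k x
  proof (cases "\<theta>' (c k * (x \<bullet> x)) = 0")
    case False
    then have "\<not> (c k * (x \<bullet> x) \<le> 1 \<or> 2 \<le> c k * (x \<bullet> x))" using \<theta>(7) by blast
    then have "c k * (x \<bullet> x) < 2" "x \<noteq> 0" by auto
    then have "c k * norm x \<le> 2 / norm x"
      by (simp add: divide_simps power2_norm_eq_inner[symmetric] power2_eq_square mult_ac)
    then have le: "4 * (2 * c k * norm x) \<le> 16 / norm x" by simp
    have "norm (D\<eta> k x) = \<bar>\<theta>' (c k * (x \<bullet> x))\<bar> * (2 * c k * norm x)"
      using c[of k] by (simp add: D\<eta>_def abs_mult)
    also have "\<dots> \<le> 4 * (2 * c k * norm x)"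
      using c[of k] by (intro mult_right_mono \<theta>(6)) simp
    also note le
    finally show ?thesis .
  qed (simp add: D\<eta>_def)
  have intG: "integrable (lebesgue_on \<Omega>) (\<lambda>x. \<phi> x *\<^sub>R G x)"
    using C1_c_continuous[OF \<phi>] M(2) int(2)
    by (intro integrable_bounded_scaleR borel_measurable_lebesgue_on borel_measurable_continuous_onI) auto
  have intu: "integrable (lebesgue_on \<Omega>) (\<lambda>x. u x *\<^sub>R gradient \<phi> x)"
    using C1_c_continuous_gradient[OF \<phi>] M(3) int(1)
    by (intro integrable_scaleR_bounded borel_measurable_lebesgue_on borel_measurable_continuous_onI) auto
  have "(\<lambda>k. integral\<^sup>L (lebesgue_on \<Omega>) (P k)) \<longlonglongrightarrow>
      (\<integral>x. \<phi> x *\<^sub>R G x + u x *\<^sub>R gradient \<phi> x \<partial>lebesgue_on \<Omega>)"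
  proof (rule integral_dominated_convergence)
    show "integrable (lebesgue_on \<Omega>) (\<lambda>x. M * norm (G x) + \<bar>u x\<bar> * M + 16 * M * \<bar>u x / norm x\<bar>)"
      using int by (intro Bochner_Integration.integrable_add integrable_mult_right integrable_mult_left
          integrable_norm integrable_abs)
    show "AE x in lebesgue_on \<Omega>. norm (P k x) \<le> M * norm (G x) + \<bar>u x\<bar> * M + 16 * M * \<bar>u x / norm x\<bar>" for k
    proof (rule AE_I2)
      fix x
      have "norm (P k x) \<le> norm (\<eta> k x *\<^sub>R (\<phi> x *\<^sub>R G x + u x *\<^sub>R gradient \<phi> x)) + norm ((\<phi> x * u x) *\<^sub>R D\<eta> k x)"
        unfolding P_def by (rule norm_triangle_ineq)
      also have "norm (\<eta> k x *\<^sub>R (\<phi> x *\<^sub>R G x + u x *\<^sub>R gradient \<phi> x)) \<le> norm (\<phi> x *\<^sub>R G x + u x *\<^sub>R gradient \<phi> x)"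
        using \<theta>(5) by (simp add: \<eta>_def mult_left_le_one_le)
      also have "\<dots> \<le> M * norm (G x) + \<bar>u x\<bar> * M"
        using M by (intro norm_triangle_le add_mono) (auto intro!: mult_mono)
      also have "norm ((\<phi> x * u x) *\<^sub>R D\<eta> k x) \<le> (M * \<bar>u x\<bar>) * (16 / norm x)"
        unfolding norm_scaleR abs_mult using M by (intro mult_mono D\<eta>_bound) auto
      finally show "norm (P k x) \<le> M * norm (G x) + \<bar>u x\<bar> * M + 16 * M * \<bar>u x / norm x\<bar>"
        by (simp add: mult_ac)
    qed
    show "AE x in lebesgue_on \<Omega>. (\<lambda>k. P k x) \<longlonglongrightarrow> \<phi> x *\<^sub>R G x + u x *\<^sub>R gradient \<phi> x"
      using AE_nonzero_lebesgue_on[OF \<Omega>]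
    proof (rule AE_mp, intro AE_I2 impI)
      fix x :: 'a assume "x \<noteq> 0"
      then have xx: "0 < x \<bullet> x" by simp
      obtain N where N: "2 / (x \<bullet> x) < real N" using reals_Archimedean2 by blast
      have "\<forall>\<^sub>F k in sequentially. 2 \<le> c k * (x \<bullet> x)"
      proof (rule eventually_sequentiallyI[of N])
        fix k assume "N \<le> k"
        then have "2 / (x \<bullet> x) \<le> real (Suc k)" using N by simp
        also have "\<dots> \<le> c k" unfolding c_def by (rule self_le_power) simp_all
        finally show "2 \<le> c k * (x \<bullet> x)" using xx by (simp add: pos_divide_le_eq)
      qed
      then have "\<forall>\<^sub>F k in sequentially. P k x = \<phi> x *\<^sub>R G x + u x *\<^sub>R gradient \<phi> x"
        by eventually_elim (use \<theta>(4,7) in \<open>simp add: P_def \<eta>_def D\<eta>_def\<close>)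
      then show "(\<lambda>k. P k x) \<longlonglongrightarrow> \<phi> x *\<^sub>R G x + u x *\<^sub>R gradient \<phi> x" by (rule tendsto_eventually)
    qed
    show "P k \<in> borel_measurable (lebesgue_on \<Omega>)" for k
      using P(1) by (intro borel_measurable_lebesgue_on borel_measurable_continuous_onI)
    show "(\<lambda>x. \<phi> x *\<^sub>R G x + u x *\<^sub>R gradient \<phi> x) \<in> borel_measurable (lebesgue_on \<Omega>)"
      using intG intu by (intro borel_measurable_add borel_measurable_integrable)
  qed
  moreover have "integral\<^sup>L (lebesgue_on \<Omega>) (P k) = 0" for k
  proof -
    have "P k x = 0" if "x \<notin> \<Omega>" for x
    proof -
      have "x \<notin> closure {x. \<phi> x \<noteq> 0}" using that C1_c_compact_support(2)[OF \<phi>] by blast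
      then show ?thesis using C1_c_eq_0[of x \<phi>] C1_c_gradient_eq_0[of x \<phi>] by (simp add: P_def)
    qed
    then show ?thesis using integral_lebesgue_on_eq_lborel[OF P(1) _ \<Omega>] P(2) by simp
  qed
  ultimately have "(\<integral>x. \<phi> x *\<^sub>R G x + u x *\<^sub>R gradient \<phi> x \<partial>lebesgue_on \<Omega>) = 0"
    by (simp add: LIMSEQ_const_iff)
  then show "(\<integral>x. u x *\<^sub>R gradient \<phi> x \<partial>lebesgue_on \<Omega>) = - (\<integral>x. \<phi> x *\<^sub>R G x \<partial>lebesgue_on \<Omega>)"
    using intG intu by (simp add: eq_neg_iff_add_eq_0 add.commute)
qed

section \<open>Fields with at most logarithmic singularities\<close>

text \<open>
  Only the diagonal entries \<open>D i \<bullet> i\<close> enter, so a field is weakly divergence free as soon as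
  their sum vanishes almost everywhere.
\<close>
lemma integral_inner_gradient_eq_divergence:
  fixes F :: "'a::euclidean_space \<Rightarrow> 'a" and D :: "'a \<Rightarrow> 'a \<Rightarrow> 'a"
  assumes wg: "\<And>i. i \<in> Basis \<Longrightarrow> has_weak_gradient \<Omega> (\<lambda>x. F x \<bullet> i) (D i)"
    and F: "integrable (lebesgue_on \<Omega>) F"
    and D: "\<And>i. i \<in> Basis \<Longrightarrow> integrable (lebesgue_on \<Omega>) (D i)"
    and \<phi>: "\<phi> \<in> C1_c \<Omega>"
  shows "(\<integral>x. F x \<bullet> gradient \<phi> x \<partial>lebesgue_on \<Omega>) =
    - (\<integral>x. \<phi> x * (\<Sum>i\<in>Basis. D i x \<bullet> i) \<partial>lebesgue_on \<Omega>)"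
proof -
  obtain M where M: "0 \<le> M" "\<And>x. \<bar>\<phi> x\<bar> \<le> M" "\<And>x. norm (gradient \<phi> x) \<le> M"
    using C1_c_bounded[OF \<phi>] by blast
  have intF: "integrable (lebesgue_on \<Omega>) (\<lambda>x. (F x \<bullet> i) *\<^sub>R gradient \<phi> x)" for i
    using C1_c_continuous_gradient[OF \<phi>] M(3) F
    by (intro integrable_scaleR_bounded borel_measurable_lebesgue_on borel_measurable_continuous_onI integrable_inner_left) auto
  have intD: "integrable (lebesgue_on \<Omega>) (\<lambda>x. \<phi> x *\<^sub>R D i x)" if "i \<in> Basis" for i
    using C1_c_continuous[OF \<phi>] M(2) D[OF that]
    by (intro integrable_bounded_scaleR borel_measurable_lebesgue_on borel_measurable_continuous_onI) auto
  have "(\<integral>x. F x \<bullet> gradient \<phi> x \<partial>lebesgue_on \<Omega>) =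
      (\<integral>x. (\<Sum>i\<in>Basis. ((F x \<bullet> i) *\<^sub>R gradient \<phi> x) \<bullet> i) \<partial>lebesgue_on \<Omega>)"
    by (intro Bochner_Integration.integral_cong refl) (subst euclidean_inner, simp)
  also have "\<dots> = (\<Sum>i\<in>Basis. (\<integral>x. (F x \<bullet> i) *\<^sub>R gradient \<phi> x \<partial>lebesgue_on \<Omega>) \<bullet> i)"
    using intF by (subst Bochner_Integration.integral_sum) (auto simp del: inner_scaleR_left intro!: integrable_inner_left sum.cong integral_inner_left)
  also have "\<dots> = (\<Sum>i\<in>Basis. - (\<integral>x. \<phi> x *\<^sub>R D i x \<partial>lebesgue_on \<Omega>) \<bullet> i)"
    using wg \<phi> by (intro sum.cong refl) (simp add: has_weak_gradient_def)
  also have "\<dots> = - (\<Sum>i\<in>Basis. (\<integral>x. (\<phi> x *\<^sub>R D i x) \<bullet> i \<partial>lebesgue_on \<Omega>))"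
    using intD by (simp add: sum_negf integral_inner_left del: inner_scaleR_left)
  also have "\<dots> = - (\<integral>x. (\<Sum>i\<in>Basis. (\<phi> x *\<^sub>R D i x) \<bullet> i) \<partial>lebesgue_on \<Omega>)"
    using intD by (subst Bochner_Integration.integral_sum) (auto simp del: inner_scaleR_left intro!: integrable_inner_left)
  finally show ?thesis by (simp add: sum_distrib_left)
qed

lemma five_minus_ln_pos: "0 < 5 - ln r" if "0 < r" "r < 1" for r :: real
  using ln_less_zero[OF that] by linarith

text \<open>
  Any power of the logarithm is absorbed by \<open>|x|^(-1/2)\<close>, and \<open>|x|^(-3/2)\<close> is integrable since
  \<open>3/2 < 2 \<le> n\<close>.
\<close>
lemma integrable_log_powr_div_norm:
  fixes p :: real
  assumes n: "2 \<le> DIM('a::euclidean_space)" and p: "0 < p"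
  shows "integrable (lebesgue_on (ball (0::'a) 1)) (\<lambda>x. (5 - ln (norm x)) powr p / norm x)"
proof -
  \<comment> \<open>This exponent makes \<open>(t powr a) powr p\<close> the square root of \<open>t\<close>.\<close>
  define a where "a = 1 / (2 * p)"
  have a: "0 < a" "a * p = 1 / 2" using p by (simp_all add: a_def)
  define C where "C = exp (5 / 2) / a powr p"
  have bound: "(5 - ln r) powr p / r \<le> C * (1 / r) powr (3/2)" if r: "0 < r" "r < 1" for r :: real
  proof -
    have t: "1 \<le> exp 5 / r" using r less_trans[of r 1 "exp 5"] by (simp add: le_divide_eq)
    have "5 - ln r = ln (exp 5 / r)" using r by (simp add: ln_div)
    also have "\<dots> \<le> (exp 5 / r) powr a / a" using t a by (intro ln_powr_bound)
    finally have "(5 - ln r) powr p \<le> ((exp 5 / r) powr a / a) powr p"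
      using p five_minus_ln_pos[OF r] by (intro powr_mono2) auto
    also have "\<dots> = ((exp 5 / r) powr a) powr p / a powr p"
      by (simp only: powr_divide)
    also have "\<dots> = (exp 5 / r) powr (1/2) / a powr p"
      by (simp only: powr_powr a(2))
    also have "\<dots> = C * (1 / r) powr (1/2)"
      using r by (simp add: C_def powr_divide exp_powr_real)
    finally have "(5 - ln r) powr p / r \<le> C * (1 / r) powr (1/2) / r"
      using r by (intro divide_right_mono) auto
    also have "\<dots> = C * ((1 / r) powr (1/2) * (1 / r) powr 1)" using r by simp
    also have "(1 / r) powr (1/2) * (1 / r) powr 1 = (1 / r) powr (3/2)"
      by (subst powr_add[symmetric]) simp
    finally show ?thesis .
  qed
  have C: "0 \<le> C" by (simp add: C_def)
  show ?thesis
  proof (rule Bochner_Integration.integrable_bound)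
    show "integrable (lebesgue_on (ball (0::'a) 1)) (\<lambda>x. C * (1 / norm x) powr (3/2))"
      using n by (intro integrable_mult_right integrable_norm_powr_ball) auto
    show "(\<lambda>x::'a. (5 - ln (norm x)) powr p / norm x) \<in> borel_measurable (lebesgue_on (ball 0 1))"
      by (rule borel_measurable_lebesgue_on) measurable
    have "AE x in lebesgue_on (ball (0::'a) 1). x \<noteq> 0" by (rule AE_nonzero_lebesgue_on) simp
    then show "AE x in lebesgue_on (ball (0::'a) 1).
        norm ((5 - ln (norm x)) powr p / norm x) \<le> norm (C * (1 / norm x) powr (3/2))"
    proof (rule AE_mp, intro AE_I2 impI)
      fix x :: 'a assume "x \<in> space (lebesgue_on (ball 0 1))" "x \<noteq> 0"
      then show "norm ((5 - ln (norm x)) powr p / norm x) \<le> norm (C * (1 / norm x) powr (3/2))"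
        using bound[of "norm x"] C by simp
    qed
  qed
qed

lemma integrable_log_bounded:
  fixes f :: "'a::euclidean_space \<Rightarrow> 'b::euclidean_space"
  assumes n: "2 \<le> DIM('a)" and U: "open U" "U \<subseteq> ball 0 1" and p: "0 < p"
    and f: "f \<in> borel_measurable borel"
    and bound: "\<And>x. x \<in> ball 0 1 - {0} \<Longrightarrow> norm (f x) \<le> C * (5 - ln (norm x)) powr p / norm x"
  shows "integrable (lebesgue_on U) f"
proof (rule integrable_lebesgue_on_subset)
  show "integrable (lebesgue_on (ball 0 1)) f"
  proof (rule Bochner_Integration.integrable_bound)
    show "integrable (lebesgue_on (ball 0 1)) (\<lambda>x::'a. C * ((5 - ln (norm x)) powr p / norm x))"
      using n p by (intro integrable_mult_right integrable_log_powr_div_norm)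
    show "f \<in> borel_measurable (lebesgue_on (ball 0 1))" using f by (rule borel_measurable_lebesgue_on)
    have "AE x in lebesgue_on (ball (0::'a) 1). x \<noteq> 0" by (rule AE_nonzero_lebesgue_on) simp
    then show "AE x in lebesgue_on (ball 0 1). norm (f x) \<le> norm (C * ((5 - ln (norm x)) powr p / norm x))"
    proof (rule AE_mp, intro AE_I2 impI)
      fix x :: 'a assume "x \<in> space (lebesgue_on (ball 0 1))" "x \<noteq> 0"
      then have "norm (f x) \<le> C * ((5 - ln (norm x)) powr p / norm x)"
        using bound[of x] by simp
      then show "norm (f x) \<le> norm (C * ((5 - ln (norm x)) powr p / norm x))"
        using abs_ge_self order_trans unfolding real_norm_def by blast
    qed
  qed
qed (use U in auto)

lemma Lp_log_bounded:
  fixes f :: "'a::euclidean_space \<Rightarrow> 'b::euclidean_space"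
  assumes n: "2 \<le> DIM('a)" and U: "open U" "U \<subseteq> ball 0 1" and p: "0 < p"
    and f: "f \<in> borel_measurable borel"
    and bound: "\<And>x. x \<in> ball 0 1 - {0} \<Longrightarrow> norm (f x) \<le> 5 - ln (norm x)"
  shows "f \<in> Lp (ereal p) U"
proof -
  have "integrable (lebesgue_on U) (\<lambda>x. norm (f x) powr p)"
  proof (rule integrable_log_bounded[where C = 1, OF n U p])
    fix x :: 'a assume x: "x \<in> ball 0 1 - {0}"
    have "norm (f x) powr p \<le> (5 - ln (norm x)) powr p"
      using bound[OF x] p by (intro powr_mono2) auto
    also have "\<dots> \<le> (5 - ln (norm x)) powr p / norm x"
      using x by (simp add: divide_simps mult_left_le)
    finally show "norm (norm (f x) powr p) \<le> 1 * (5 - ln (norm x)) powr p / norm x" by simp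
  qed (use f in measurable)
  then show ?thesis using f by (simp add: Lp_def borel_measurable_lebesgue_on)
qed

text \<open>
  The two bounds are those of a logarithm and of its derivative. In the unit ball they give \<open>u\<close>, \<open>u / |x|\<close>
  and \<open>G\<close> one common integrable majorant.
\<close>
lemma has_weak_gradient_log_bounded:
  fixes u :: "'a::euclidean_space \<Rightarrow> real"
  assumes n: "2 \<le> DIM('a)" and U: "open U" "U \<subseteq> ball 0 1"
    and meas: "u \<in> borel_measurable borel" "G \<in> borel_measurable borel"
    and u: "\<And>x. x \<noteq> 0 \<Longrightarrow> GDERIV u x :> G x" "continuous_on (- {0}) G"
    and bound: "\<And>x. x \<in> ball 0 1 - {0} \<Longrightarrow> \<bar>u x\<bar> \<le> C * (5 - ln (norm x))"
      "\<And>x. x \<in> ball 0 1 - {0} \<Longrightarrow> norm (G x) \<le> C * (5 - ln (norm x)) / norm x"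
  shows "has_weak_gradient U u G" "integrable (lebesgue_on U) u" "integrable (lebesgue_on U) G"
proof -
  have pos: "0 < 5 - ln (norm x)" if "x \<in> ball 0 1 - {0}" for x :: 'a
    using that by (intro five_minus_ln_pos) auto
  show intG: "integrable (lebesgue_on U) G"
  proof (rule integrable_log_bounded[OF n U zero_less_one meas(2), of C])
    fix x :: 'a assume x: "x \<in> ball 0 1 - {0}"
    show "norm (G x) \<le> C * (5 - ln (norm x)) powr 1 / norm x"
      using bound(2)[OF x] pos[OF x] by simp
  qed
  show intu: "integrable (lebesgue_on U) u"
  proof (rule integrable_log_bounded[OF n U zero_less_one meas(1), of C])
    fix x :: 'a assume x: "x \<in> ball 0 1 - {0}"
    have nn: "0 \<le> C * (5 - ln (norm x))" using order_trans[OF abs_ge_zero bound(1)[OF x]] .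
    have "\<bar>u x\<bar> \<le> C * (5 - ln (norm x)) / 1" using bound(1)[OF x] by simp
    also have "\<dots> \<le> C * (5 - ln (norm x)) / norm x"
      using x nn by (intro divide_left_mono) auto
    finally show "norm (u x) \<le> C * (5 - ln (norm x)) powr 1 / norm x" using pos[OF x] by simp
  qed
  have "integrable (lebesgue_on U) (\<lambda>x. u x / norm x)"
  proof (rule integrable_log_bounded[OF n U zero_less_one, of _ C])
    show "(\<lambda>x. u x / norm x) \<in> borel_measurable borel" using meas by measurable
    fix x :: 'a assume x: "x \<in> ball 0 1 - {0}"
    show "norm (u x / norm x) \<le> C * (5 - ln (norm x)) powr 1 / norm x"
      using bound(1)[OF x] pos[OF x] by (simp add: divide_right_mono)
  qed
  then show "has_weak_gradient U u G"
    using intu intG u U by (intro has_weak_gradient_removable_singularity)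
      (auto intro: continuous_on_subset)
qed

section \<open>The solution, its flux and their divergence\<close>

text \<open>
  The constant \<open>4\<close> makes \<open>\<kappa> / log_weight x\<close> at most \<open>1/2\<close> in the unit ball whenever \<open>\<kappa> \<le> 2\<close>.
\<close>
definition log_weight :: "'a::real_normed_vector \<Rightarrow> real" where
  "log_weight x = 4 - ln (norm x)"

definition log_sol :: "'a::real_inner \<Rightarrow> 'a \<Rightarrow> real" where
  "log_sol e x = (x \<bullet> e) * log_weight x"

definition log_sol_grad :: "'a::real_inner \<Rightarrow> 'a \<Rightarrow> 'a" where
  "log_sol_grad e x = log_weight x *\<^sub>R e - ((x \<bullet> e) / (norm x)\<^sup>2) *\<^sub>R x"

text \<open>
  The field \<open>A \<nabla>u\<close> in closed form (see \<open>coeff_matrix_mult_log_sol_grad\<close>), with \<open>\<kappa> = n / (n - 1)\<close> in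
  dimension \<open>n\<close>.
\<close>
definition flux :: "real \<Rightarrow> 'a::real_inner \<Rightarrow> 'a \<Rightarrow> 'a" where
  "flux \<kappa> e x = (log_weight x - \<kappa>) *\<^sub>R e + ((\<kappa> - 1) * ((x \<bullet> e) / (norm x)\<^sup>2)) *\<^sub>R x"

text \<open>
  The gradient of the component \<open>flux \<kappa> e x \<bullet> i\<close>, so that the trace over \<open>i\<close> is the divergence of the
  flux.
\<close>
definition flux_grad :: "real \<Rightarrow> 'a::real_inner \<Rightarrow> 'a \<Rightarrow> 'a \<Rightarrow> 'a" where
  "flux_grad \<kappa> e i x = - ((e \<bullet> i) / (norm x)\<^sup>2) *\<^sub>R x +
     (\<kappa> - 1) *\<^sub>R ((1 / (norm x)\<^sup>2) *\<^sub>R ((x \<bullet> i) *\<^sub>R e + (x \<bullet> e) *\<^sub>R i) -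
       (2 * (x \<bullet> e) * (x \<bullet> i) / (norm x) ^ 4) *\<^sub>R x)"

lemma borel_measurable_log_sol [measurable]:
  fixes e :: "'a::euclidean_space"
  shows "log_sol e \<in> borel_measurable borel" "log_sol_grad e \<in> borel_measurable borel"
    "flux \<kappa> e \<in> borel_measurable borel" "flux_grad \<kappa> e i \<in> borel_measurable borel"
  unfolding log_sol_def[abs_def] log_sol_grad_def[abs_def] flux_def[abs_def] flux_grad_def[abs_def]
    log_weight_def[abs_def] by measurable

lemma continuous_on_log_sol_grad:
  "continuous_on (- {0}) (log_sol_grad e)" "continuous_on (- {0}) (flux_grad \<kappa> e i)"
  unfolding log_sol_grad_def[abs_def] flux_grad_def[abs_def] log_weight_def[abs_def]
  by (intro continuous_intros; simp)+

lemma GDERIV_log_weight: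
  fixes x :: "'a::real_inner"
  assumes "x \<noteq> 0"
  shows "GDERIV log_weight x :> - (1 / (norm x)\<^sup>2) *\<^sub>R x"
proof -
  have "GDERIV (\<lambda>x::'a. ln (norm x)) x :> (1 / norm x) *\<^sub>R sgn x"
    using assms by (intro GDERIV_DERIV_compose GDERIV_norm) (auto intro!: derivative_eq_intros)
  from GDERIV_diff[OF GDERIV_const[of 4] this] show ?thesis
    unfolding log_weight_def[abs_def]
    by (simp add: sgn_div_norm power2_eq_square divide_simps)
qed

lemma GDERIV_inner_left: "GDERIV (\<lambda>x. x \<bullet> e) x :> e"
  unfolding gderiv_def by (auto intro!: derivative_eq_intros)

lemma GDERIV_log_sol:
  assumes "x \<noteq> 0"
  shows "GDERIV (log_sol e) x :> log_sol_grad e x"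
proof -
  have "GDERIV (\<lambda>x. (x \<bullet> e) * log_weight x) x :>
      (x \<bullet> e) *\<^sub>R (- (1 / (norm x)\<^sup>2) *\<^sub>R x) + log_weight x *\<^sub>R e"
    by (intro GDERIV_mult GDERIV_inner_left GDERIV_log_weight assms)
  then show ?thesis by (simp add: log_sol_def[abs_def] log_sol_grad_def)
qed

lemma GDERIV_norm_squared: "GDERIV (\<lambda>x. (norm x)\<^sup>2) x :> 2 *\<^sub>R x"
  unfolding gderiv_def power2_norm_eq_inner
  by (auto intro!: derivative_eq_intros simp: inner_commute)

lemma GDERIV_flux:
  assumes "x \<noteq> 0"
  shows "GDERIV (\<lambda>x. flux \<kappa> e x \<bullet> i) x :> flux_grad \<kappa> e i x"
proof -
  have inv: "GDERIV (\<lambda>x. inverse ((norm x)\<^sup>2)) x :> - (inverse ((norm x)\<^sup>2))\<^sup>2 *\<^sub>R 2 *\<^sub>R x"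
    using assms by (intro GDERIV_inverse GDERIV_norm_squared) simp
  have "GDERIV (\<lambda>x. (log_weight x - \<kappa>) * (e \<bullet> i) + (\<kappa> - 1) * (((x \<bullet> e) * (x \<bullet> i)) * inverse ((norm x)\<^sup>2))) x :>
      ((log_weight x - \<kappa>) *\<^sub>R 0 + (e \<bullet> i) *\<^sub>R (- (1 / (norm x)\<^sup>2) *\<^sub>R x - 0)) +
      ((\<kappa> - 1) *\<^sub>R (((x \<bullet> e) * (x \<bullet> i)) *\<^sub>R (- (inverse ((norm x)\<^sup>2))\<^sup>2 *\<^sub>R 2 *\<^sub>R x)
         + inverse ((norm x)\<^sup>2) *\<^sub>R ((x \<bullet> e) *\<^sub>R i + (x \<bullet> i) *\<^sub>R e))
       + (((x \<bullet> e) * (x \<bullet> i)) * inverse ((norm x)\<^sup>2)) *\<^sub>R 0)"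
    by (intro GDERIV_add GDERIV_mult GDERIV_diff GDERIV_const GDERIV_inner_left GDERIV_log_weight inv assms)
  moreover have "(\<lambda>x. (log_weight x - \<kappa>) * (e \<bullet> i) + (\<kappa> - 1) * (((x \<bullet> e) * (x \<bullet> i)) * inverse ((norm x)\<^sup>2)))
      = (\<lambda>x. flux \<kappa> e x \<bullet> i)"
    by (auto simp: flux_def inner_add_left divide_inverse mult_ac)
  moreover have "(inverse ((norm x)\<^sup>2))\<^sup>2 = inverse (norm x ^ 4)"
    by (simp add: power_inverse[symmetric] flip: power_mult)
  ultimately show ?thesis
    by (simp add: flux_grad_def algebra_simps divide_inverse)
qed

text \<open>
  The term \<open>v e\<close> contributes \<open>- (x \<bullet> e) / |x|\<^sup>2\<close>, and the field \<open>((x \<bullet> e) / |x|\<^sup>2) x\<close> has divergence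
  \<open>(n - 1) (x \<bullet> e) / |x|\<^sup>2\<close>. They cancel exactly when \<open>(\<kappa> - 1) (n - 1) = 1\<close>.
\<close>
lemma div_flux_eq_0:
  fixes x e :: "'a::euclidean_space"
  assumes n: "2 \<le> DIM('a)" and x: "x \<noteq> 0" and \<kappa>: "\<kappa> = real DIM('a) / (real DIM('a) - 1)"
  shows "(\<Sum>i\<in>Basis. flux_grad \<kappa> e i x \<bullet> i) = 0"
proof -
  have n1: "real DIM('a) \<noteq> 1" using n by simp
  \<comment> \<open>The divergence is \<open>\<alpha> (x \<bullet> e) + \<beta> |x|\<^sup>2 + n \<gamma>\<close>.\<close>
  define \<alpha> where "\<alpha> = (\<kappa> - 2) / (norm x)\<^sup>2"
  define \<beta> where "\<beta> = - ((\<kappa> - 1) * (2 * (x \<bullet> e) / (norm x) ^ 4))"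
  define \<gamma> where "\<gamma> = (\<kappa> - 1) * ((x \<bullet> e) / (norm x)\<^sup>2)"
  have "flux_grad \<kappa> e i x \<bullet> i = \<alpha> * ((x \<bullet> i) * (e \<bullet> i)) + \<beta> * ((x \<bullet> i) * (x \<bullet> i)) + \<gamma>"
    if "i \<in> Basis" for i
    using that
    by (simp add: flux_grad_def \<alpha>_def \<beta>_def \<gamma>_def inner_add_left inner_diff_left inner_Basis
        algebra_simps add_divide_distrib diff_divide_distrib)
  then have "(\<Sum>i\<in>Basis. flux_grad \<kappa> e i x \<bullet> i) =
      \<alpha> * (\<Sum>i\<in>Basis. (x \<bullet> i) * (e \<bullet> i)) + \<beta> * (\<Sum>i\<in>Basis. (x \<bullet> i) * (x \<bullet> i)) + DIM('a) * \<gamma>"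
    by (simp add: sum.distrib sum_distrib_left)
  also have "\<dots> = \<alpha> * (x \<bullet> e) + \<beta> * (norm x)\<^sup>2 + DIM('a) * \<gamma>"
    by (simp add: euclidean_inner[symmetric] power2_norm_eq_inner)
  also have "\<beta> * (norm x)\<^sup>2 = - 2 * \<gamma>"
    using x by (simp add: \<beta>_def \<gamma>_def divide_simps)
  also have "\<alpha> * (x \<bullet> e) + - 2 * \<gamma> + DIM('a) * \<gamma> =
      ((x \<bullet> e) / (norm x)\<^sup>2) * ((\<kappa> - 1) * (real DIM('a) - 1) - 1)"
    by (simp add: \<alpha>_def \<gamma>_def algebra_simps add_divide_distrib diff_divide_distrib)
  also have "(\<kappa> - 1) * (real DIM('a) - 1) = 1" using n1 by (simp add: \<kappa> field_simps)
  finally show ?thesis by simp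
qed

lemma norm_inner_ratio_le:
  assumes "norm e = 1"
  shows "norm (((x \<bullet> e) / (norm x)\<^sup>2) *\<^sub>R x) \<le> 1"
proof (cases "x = 0")
  case False
  have "\<bar>x \<bullet> e\<bar> \<le> norm x" using Cauchy_Schwarz_ineq2[of x e] assms by simp
  then show ?thesis using False by (simp add: power2_eq_square divide_simps)
qed simp

lemma log_sol_bounds:
  assumes e: "norm e = 1" and x: "x \<in> ball 0 1 - {0}"
  shows "\<bar>log_sol e x\<bar> \<le> 5 - ln (norm x)" "norm (log_sol_grad e x) \<le> 5 - ln (norm x)"
proof -
  have l: "ln (norm x) < 0" using x by (intro ln_less_zero) auto
  have "\<bar>x \<bullet> e\<bar> \<le> 1" using Cauchy_Schwarz_ineq2[of x e] x e by simp
  then have "\<bar>log_sol e x\<bar> \<le> 1 * (4 - ln (norm x))"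
    using l unfolding log_sol_def log_weight_def abs_mult by (intro mult_mono) auto
  then show "\<bar>log_sol e x\<bar> \<le> 5 - ln (norm x)" by simp
  have "norm (log_sol_grad e x) \<le> norm (log_weight x *\<^sub>R e) + norm (((x \<bullet> e) / (norm x)\<^sup>2) *\<^sub>R x)"
    unfolding log_sol_grad_def by (rule norm_triangle_ineq4)
  also have "\<dots> \<le> (4 - ln (norm x)) + 1"
    using l e by (intro add_mono norm_inner_ratio_le) (auto simp: log_weight_def)
  finally show "norm (log_sol_grad e x) \<le> 5 - ln (norm x)" by simp
qed

text \<open>
  The three terms of the gradient contribute at most \<open>1\<close>, \<open>2\<close> and \<open>2\<close> times \<open>1 / |x|\<close>, which is why
  the common majorant is \<open>5 - ln |x|\<close> rather than the smaller \<open>4 - ln |x|\<close>.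
\<close>
lemma flux_bounds:
  assumes e: "norm e = 1" and i: "norm i = 1" and x: "x \<in> ball 0 1 - {0}" and \<kappa>: "1 \<le> \<kappa>" "\<kappa> \<le> 2"
  shows "\<bar>flux \<kappa> e x \<bullet> i\<bar> \<le> 5 - ln (norm x)"
    "norm (flux_grad \<kappa> e i x) \<le> (5 - ln (norm x)) / norm x"
proof -
  have l: "ln (norm x) < 0" using x by (intro ln_less_zero) auto
  have xe: "\<bar>x \<bullet> e\<bar> \<le> norm x" "\<bar>x \<bullet> i\<bar> \<le> norm x" "\<bar>e \<bullet> i\<bar> \<le> 1"
    using Cauchy_Schwarz_ineq2[of x e] Cauchy_Schwarz_ineq2[of x i] Cauchy_Schwarz_ineq2[of e i] i e by simp_all
  have "\<bar>flux \<kappa> e x \<bullet> i\<bar> \<le> norm (flux \<kappa> e x)"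
    using Cauchy_Schwarz_ineq2[of "flux \<kappa> e x" i] i by simp
  also have "\<dots> \<le> norm ((log_weight x - \<kappa>) *\<^sub>R e) + norm ((\<kappa> - 1) *\<^sub>R (((x \<bullet> e) / (norm x)\<^sup>2) *\<^sub>R x))"
    unfolding flux_def scaleR_scaleR by (rule norm_triangle_ineq)
  also have "norm ((log_weight x - \<kappa>) *\<^sub>R e) = 4 - ln (norm x) - \<kappa>"
    using l \<kappa> e by (simp add: log_weight_def)
  also have "norm ((\<kappa> - 1) *\<^sub>R (((x \<bullet> e) / (norm x)\<^sup>2) *\<^sub>R x)) \<le> 1 * 1"
    unfolding norm_scaleR[of "\<kappa> - 1"] using \<kappa> by (intro mult_mono norm_inner_ratio_le e) auto
  finally show "\<bar>flux \<kappa> e x \<bullet> i\<bar> \<le> 5 - ln (norm x)" using \<kappa> by simp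
  have 1: "norm (- ((e \<bullet> i) / (norm x)\<^sup>2) *\<^sub>R x) \<le> 1 / norm x"
    using xe(3) x by (simp add: power2_eq_square divide_simps)
  have "norm ((x \<bullet> i) *\<^sub>R e + (x \<bullet> e) *\<^sub>R i) \<le> 2 * norm x"
    using xe e i by (intro norm_triangle_le) simp
  then have 2: "norm ((1 / (norm x)\<^sup>2) *\<^sub>R ((x \<bullet> i) *\<^sub>R e + (x \<bullet> e) *\<^sub>R i)) \<le> 2 / norm x"
    using x by (simp add: power2_eq_square divide_simps)
  have "\<bar>x \<bullet> e\<bar> * \<bar>x \<bullet> i\<bar> \<le> norm x * norm x" using xe by (intro mult_mono) auto
  then have 3: "norm ((2 * (x \<bullet> e) * (x \<bullet> i) / (norm x) ^ 4) *\<^sub>R x) \<le> 2 / norm x"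
    using x by (simp add: abs_mult power4_eq_xxxx divide_simps) 
  have "norm (flux_grad \<kappa> e i x) \<le> 1 / norm x + 1 * (2 / norm x + 2 / norm x)"
    unfolding flux_grad_def
  proof (intro norm_triangle_le add_mono 1)
    show "norm ((\<kappa> - 1) *\<^sub>R ((1 / (norm x)\<^sup>2) *\<^sub>R ((x \<bullet> i) *\<^sub>R e + (x \<bullet> e) *\<^sub>R i) -
       (2 * (x \<bullet> e) * (x \<bullet> i) / (norm x) ^ 4) *\<^sub>R x)) \<le> 1 * (2 / norm x + 2 / norm x)"
      unfolding norm_scaleR[of "\<kappa> - 1"] using \<kappa>
      by (intro mult_mono norm_triangle_le_diff add_mono 2 3) auto
  qed
  also have "\<dots> = 5 / norm x" by simp
  also have "\<dots> \<le> (5 - ln (norm x)) / norm x"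
    using l by (intro divide_right_mono) auto
  finally show "norm (flux_grad \<kappa> e i x) \<le> (5 - ln (norm x)) / norm x" .
qed

context
  fixes e :: "'a::euclidean_space" and U :: "'a set"
  assumes n: "2 \<le> DIM('a)" and e: "e \<in> Basis" and U: "open U" "U \<subseteq> ball 0 1"
begin

lemma has_weak_gradient_log_sol:
  "has_weak_gradient U (log_sol e) (log_sol_grad e)"
  and integrable_log_sol_grad: "integrable (lebesgue_on U) (log_sol_grad e)"
proof -
  have b: "norm (log_sol_grad e x) \<le> 1 * (5 - ln (norm x)) / norm x" if x: "x \<in> ball 0 1 - {0}" for x
  proof -
    have "norm (log_sol_grad e x) \<le> 5 - ln (norm x)"
      using log_sol_bounds(2)[of e x] e x by simp
    also have "\<dots> \<le> 1 * (5 - ln (norm x)) / norm x"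
      using x five_minus_ln_pos[of "norm x"] by (simp add: divide_simps mult_left_le)
    finally show ?thesis .
  qed
  have a: "\<bar>log_sol e x\<bar> \<le> 1 * (5 - ln (norm x))" if x: "x \<in> ball 0 1 - {0}" for x
    using log_sol_bounds(1)[of e x] e x by simp
  note * = has_weak_gradient_log_bounded[OF n U borel_measurable_log_sol(1,2) GDERIV_log_sol
      continuous_on_log_sol_grad(1) a b]
  show "has_weak_gradient U (log_sol e) (log_sol_grad e)" "integrable (lebesgue_on U) (log_sol_grad e)"
    using *(1,3) by blast+
qed

lemma log_sol_W1p:
  assumes "0 < p"
  shows "log_sol e \<in> W1p (ereal p) U"
  unfolding W1p_def using e has_weak_gradient_log_sol
  by (auto intro!: Lp_log_bounded[OF n U assms] log_sol_bounds borel_measurable_log_sol exI[of _ "log_sol_grad e"])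

text \<open>
  The components of the flux have their pointwise gradients as weak gradients, so the vanishing of the
  pointwise divergence passes to the weak divergence.
\<close>
lemma integral_flux_inner_gradient:
  assumes \<phi>: "\<phi> \<in> C1_c U" and \<kappa>: "\<kappa> = real DIM('a) / (real DIM('a) - 1)"
  shows "(\<integral>x. flux \<kappa> e x \<bullet> gradient \<phi> x \<partial>lebesgue_on U) = 0"
proof -
  have k: "1 \<le> \<kappa>" "\<kappa> \<le> 2" using n by (auto simp: \<kappa> divide_simps)
  have mi: "(\<lambda>x. flux \<kappa> e x \<bullet> i) \<in> borel_measurable borel" for i by measurable
  have *: "has_weak_gradient U (\<lambda>x. flux \<kappa> e x \<bullet> i) (flux_grad \<kappa> e i)"
    "integrable (lebesgue_on U) (\<lambda>x. flux \<kappa> e x \<bullet> i)" "integrable (lebesgue_on U) (flux_grad \<kappa> e i)"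
    if i: "i \<in> Basis" for i
  proof -
    have a: "\<bar>flux \<kappa> e x \<bullet> i\<bar> \<le> 1 * (5 - ln (norm x))"
      "norm (flux_grad \<kappa> e i x) \<le> 1 * (5 - ln (norm x)) / norm x" if x: "x \<in> ball 0 1 - {0}" for x
      using flux_bounds[of e i x \<kappa>] e i x k by simp_all
    note * = has_weak_gradient_log_bounded[OF n U mi borel_measurable_log_sol(4) GDERIV_flux
        continuous_on_log_sol_grad(2) a]
    show "has_weak_gradient U (\<lambda>x. flux \<kappa> e x \<bullet> i) (flux_grad \<kappa> e i)"
      "integrable (lebesgue_on U) (\<lambda>x. flux \<kappa> e x \<bullet> i)" "integrable (lebesgue_on U) (flux_grad \<kappa> e i)"
      using * by blast+
  qed
  have "integrable (lebesgue_on U) (\<lambda>x. \<Sum>i\<in>Basis. (flux \<kappa> e x \<bullet> i) *\<^sub>R i)"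
    using * by (intro Bochner_Integration.integrable_sum integrable_scaleR_left) auto
  then have "integrable (lebesgue_on U) (flux \<kappa> e)" by (simp add: euclidean_representation)
  then have "(\<integral>x. flux \<kappa> e x \<bullet> gradient \<phi> x \<partial>lebesgue_on U) =
      - (\<integral>x. \<phi> x * (\<Sum>i\<in>Basis. flux_grad \<kappa> e i x \<bullet> i) \<partial>lebesgue_on U)"
    using * \<phi> by (intro integral_inner_gradient_eq_divergence) auto
  also have "(\<integral>x. \<phi> x * (\<Sum>i\<in>Basis. flux_grad \<kappa> e i x \<bullet> i) \<partial>lebesgue_on U) = 0"
  proof (rule integral_eq_zero_AE)
    have "AE x in lebesgue_on U. x \<noteq> 0" using U by (intro AE_nonzero_lebesgue_on) simp
    then show "AE x in lebesgue_on U. \<phi> x * (\<Sum>i\<in>Basis. flux_grad \<kappa> e i x \<bullet> i) = 0"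
      by eventually_elim (simp add: div_flux_eq_0[OF n _ \<kappa>])
  qed
  finally show ?thesis by simp
qed

end

section \<open>Bounded mean oscillation of the gradient\<close>

lemma integrable_const_lebesgue_on:
  "B \<in> lmeasurable \<Longrightarrow> integrable (lebesgue_on B) (\<lambda>x. c)"
  by (intro finite_measure.integrable_const finite_measure_lebesgue_on)

lemma integral_const_lebesgue_on:
  fixes c :: "'b::euclidean_space"
  assumes "B \<in> lmeasurable"
  shows "(\<integral>x. c \<partial>lebesgue_on B) = measure lebesgue B *\<^sub>R c"
  using assms by (simp add: measure_restrict_space fmeasurableD)

lemma integrable_norm_minus_const:
  fixes f :: "'a::euclidean_space \<Rightarrow> 'b::euclidean_space"
  assumes "B \<in> lmeasurable" "integrable (lebesgue_on B) f"
  shows "integrable (lebesgue_on B) (\<lambda>x. norm (f x - k))"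
  using assms integrable_const_lebesgue_on[of B k]
  by (intro integrable_norm Bochner_Integration.integrable_diff)

lemma average_mono:
  fixes f g :: "'a::euclidean_space \<Rightarrow> real"
  assumes "integrable (lebesgue_on B) f" "integrable (lebesgue_on B) g"
    "AE x in lebesgue_on B. f x \<le> g x"
  shows "average B f \<le> average B g"
  unfolding average_def using integral_mono_AE[OF assms] by (simp add: divide_right_mono)

lemma average_const:
  assumes "B \<in> lmeasurable" "0 < measure lebesgue B"
  shows "average B (\<lambda>x. c) = c"
  using assms by (simp add: average_def integral_const_lebesgue_on del: lebesgue_integral_const)

lemma average_add:
  assumes "integrable (lebesgue_on B) f" "integrable (lebesgue_on B) g"
  shows "average B (\<lambda>x. f x + g x) = average B f + average B g"
  using assms by (simp add: average_def scaleR_add_right)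

text \<open>
  Replacing the average by any other constant costs a factor two. This leaves the choice of the constant
  free in the estimate for logarithms.
\<close>
lemma mean_oscillation_le:
  fixes f :: "'a::euclidean_space \<Rightarrow> 'b::euclidean_space"
  assumes B: "B \<in> lmeasurable" "0 < measure lebesgue B" and f: "integrable (lebesgue_on B) f"
  shows "average B (\<lambda>x. norm (f x - average B f)) \<le> 2 * average B (\<lambda>x. norm (f x - k))"
proof -
  note const = integrable_const_lebesgue_on[OF B(1)]
  have fk: "integrable (lebesgue_on B) (\<lambda>x. f x - k)"
    using f const by (rule Bochner_Integration.integrable_diff)
  have "average B f = average B (\<lambda>x. f x - k) + average B (\<lambda>x. k)"
    using fk const by (subst average_add[symmetric]) auto
  then have "average B f - k = average B (\<lambda>x. f x - k)"
    by (simp add: average_const[OF B])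
  then have "norm (average B f - k) \<le> average B (\<lambda>x. norm (f x - k))"
    by (simp add: average_def divide_right_mono integral_norm_bound)
  have "average B (\<lambda>x. norm (f x - average B f)) \<le>
      average B (\<lambda>x. norm (f x - k) + norm (average B f - k))"
  proof (intro average_mono AE_I2)
    show "norm (f x - average B f) \<le> norm (f x - k) + norm (average B f - k)" for x
      using norm_triangle_ineq4[of "f x - k" "average B f - k"] by simp
    show "integrable (lebesgue_on B) (\<lambda>x. norm (f x - k) + norm (average B f - k))"
      by (intro Bochner_Integration.integrable_add integrable_norm_minus_const[OF B(1) f] const)
  qed (rule integrable_norm_minus_const[OF B(1) f])
  also have "\<dots> = average B (\<lambda>x. norm (f x - k)) + norm (average B f - k)"
    using fk const by (subst average_add) (auto simp: average_const[OF B])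
  finally show ?thesis using \<open>norm (average B f - k) \<le> _\<close> by simp
qed

lemma measure_ball_pos: "0 < s \<Longrightarrow> 0 < measure lebesgue (ball (z::'a::euclidean_space) s)"
  by (simp add: content_ball_pos)

text \<open>
  A ball whose centre is closer to the origin than twice its radius lies in the ball of radius \<open>3 s\<close>
  around the origin, whose measure is larger only by the factor \<open>3^n\<close>.
\<close>
lemma average_inverse_norm_le:
  fixes z :: "'a::euclidean_space"
  assumes n: "2 \<le> DIM('a)" and s: "0 < s" and z: "norm z < 2 * s"
  shows "integrable (lebesgue_on (ball z s)) (\<lambda>x. 3 * s / norm x)"
    "average (ball z s) (\<lambda>x. 3 * s / norm x) \<le> 2 / (1 - 2 powr (1 - real DIM('a))) * 3 ^ DIM('a)"
proof -
  have sub: "ball z s \<subseteq> ball 0 (3 * s)"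
  proof
    fix x assume "x \<in> ball z s"
    then show "x \<in> ball 0 (3 * s)"
      using z norm_triangle_ineq[of z "x - z"] by (simp add: dist_norm norm_minus_commute)
  qed
  have eq: "(\<lambda>x::'a. (3 * s / norm x) powr 1) = (\<lambda>x. 3 * s / norm x)" using s by auto
  have *: "integrable (lebesgue_on (ball (0::'a) (3 * s))) (\<lambda>x. 3 * s / norm x)"
    "(\<integral>x. 3 * s / norm x \<partial>lebesgue_on (ball (0::'a) (3 * s)))
      \<le> 2 powr 1 / (1 - 2 powr (1 - real DIM('a))) * measure lebesgue (ball (0::'a) (3 * s))"
    using norm_powr_ball[where 'a='a, of 1 "3 * s"] n s unfolding eq by auto
  show "integrable (lebesgue_on (ball z s)) (\<lambda>x. 3 * s / norm x)"
    by (rule integrable_lebesgue_on_subset[OF *(1) sub]) auto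
  have "(\<integral>x. 3 * s / norm x \<partial>lebesgue_on (ball z s)) \<le> (\<integral>x. 3 * s / norm x \<partial>lebesgue_on (ball (0::'a) (3 * s)))"
    using s by (intro integral_mono_lebesgue_on_AE *(1) sub) auto
  also have "\<dots> \<le> 2 / (1 - 2 powr (1 - real DIM('a))) * measure lebesgue (ball (0::'a) (3 * s))"
    using *(2) by simp
  also have "measure lebesgue (ball (0::'a) (3 * s)) = 3 ^ DIM('a) * measure lebesgue (ball z s)"
    using s by (simp add: content_ball power_mult_distrib)
  finally show "average (ball z s) (\<lambda>x. 3 * s / norm x) \<le> 2 / (1 - 2 powr (1 - real DIM('a))) * 3 ^ DIM('a)"
    using measure_ball_pos[OF s, of z] by (simp add: average_def pos_divide_le_eq mult_ac)
qed

lemma log_sol_grad_minus_const_le: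
  assumes e: "norm e = 1"
  shows "norm (log_sol_grad e x - (4 - c) *\<^sub>R e) \<le> \<bar>c - ln (norm x)\<bar> + 1"
proof -
  have "log_sol_grad e x - (4 - c) *\<^sub>R e = (c - ln (norm x)) *\<^sub>R e - ((x \<bullet> e) / (norm x)\<^sup>2) *\<^sub>R x"
    by (simp add: log_sol_grad_def log_weight_def algebra_simps)
  also have "norm \<dots> \<le> norm ((c - ln (norm x)) *\<^sub>R e) + norm (((x \<bullet> e) / (norm x)\<^sup>2) *\<^sub>R x)"
    by (rule norm_triangle_ineq4)
  also have "\<dots> \<le> \<bar>c - ln (norm x)\<bar> + 1"
    using e norm_inner_ratio_le[OF e, of x] by simp
  finally show ?thesis .
qed

text \<open>
  Up to a bounded field the gradient is a logarithm. On a ball far from the origin relative to its radius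
  \<open>|x|\<close> varies by a factor two at most, so the logarithm varies by at most \<open>ln 2\<close>. On a ball close to the
  origin \<open>ln |x|\<close> is compared with \<open>ln (3 s)\<close>, using \<open>ln t \<le> t\<close> for \<open>t = 3 s / |x|\<close>.
\<close>
lemma log_sol_grad_BMO:
  fixes e :: "'a::euclidean_space"
  assumes n: "2 \<le> DIM('a)" and e: "e \<in> Basis" and U: "open U" "U \<subseteq> ball 0 1"
  shows "log_sol_grad e \<in> BMO U"
proof -
  define K where "K = 2 / (1 - 2 powr (1 - real DIM('a))) * 3 ^ DIM('a) + 2"
  have K: "2 \<le> K" using n by (simp add: K_def less_imp_le powr_less_one)
  have ne: "norm e = 1" using e by simp
  have osc: "average (ball z s) (\<lambda>x. norm (log_sol_grad e x - average (ball z s) (log_sol_grad e))) \<le> 2 * K"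
    if s: "0 < s" "ball z s \<subseteq> U" for z s
  proof -
    let ?B = "ball z s"
    have B: "?B \<in> lmeasurable" "0 < measure lebesgue ?B" using s(1) by (auto simp: measure_ball_pos)
    have int: "integrable (lebesgue_on ?B) (log_sol_grad e)"
      using s U by (intro integrable_log_sol_grad n e) auto
    have intk: "integrable (lebesgue_on ?B) (\<lambda>x. norm (log_sol_grad e x - k))" for k
      using B(1) int by (rule integrable_norm_minus_const)
    \<comment> \<open>The comparison constants are the gradient of \<open>u\<close> with \<open>ln |x|\<close> frozen and the bounded part dropped.\<close>
    have "\<exists>k. average ?B (\<lambda>x. norm (log_sol_grad e x - k)) \<le> K"
    proof (cases "2 * s \<le> norm z")
      case True
      have "average ?B (\<lambda>x. norm (log_sol_grad e x - (4 - ln (norm z)) *\<^sub>R e)) \<le> average ?B (\<lambda>x. 2)"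
      proof (intro average_mono intk integrable_const_lebesgue_on B AE_I2)
        fix x assume "x \<in> space (lebesgue_on ?B)"
        then have "norm (z - x) < s" by (simp add: dist_norm)
        then have d: "norm z - norm x < s" "norm x - norm z < s"
          using norm_triangle_ineq2[of z x] norm_triangle_ineq2[of x z]
          by (simp_all only: norm_minus_commute[of x z])
        then have x: "norm z \<le> 2 * norm x" "norm x \<le> 2 * norm z" "0 < norm x" "0 < norm z"
          using True s(1) by linarith+
        have "ln (norm z) \<le> ln (2 * norm x)" "ln (norm x) \<le> ln (2 * norm z)"
          using x by (auto intro!: ln_mono simp del: zero_less_norm_iff)
        then have "\<bar>ln (norm z) - ln (norm x)\<bar> \<le> ln 2"
          using x by (simp add: ln_mult)
        also have "\<dots> \<le> 1" using ln_2_less_1 by simp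
        finally show "norm (log_sol_grad e x - (4 - ln (norm z)) *\<^sub>R e) \<le> 2"
          using log_sol_grad_minus_const_le[OF ne, of x "ln (norm z)"] by simp
      qed
      also have "\<dots> \<le> K" using K by (simp add: average_const[OF B])
      finally show ?thesis by blast
    next
      case False
      then have z: "norm z < 2 * s" by simp
      note avg = average_inverse_norm_le[OF n s(1) z]
      have "average ?B (\<lambda>x. norm (log_sol_grad e x - (4 - ln (3 * s)) *\<^sub>R e)) \<le> average ?B (\<lambda>x. 3 * s / norm x + 1)"
      proof (intro average_mono intk)
        show "integrable (lebesgue_on ?B) (\<lambda>x. 3 * s / norm x + 1)"
          by (intro Bochner_Integration.integrable_add avg(1) integrable_const_lebesgue_on B(1))
        have "AE x in lebesgue_on ?B. x \<noteq> 0" by (rule AE_nonzero_lebesgue_on) simp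
        then show "AE x in lebesgue_on ?B. norm (log_sol_grad e x - (4 - ln (3 * s)) *\<^sub>R e) \<le> 3 * s / norm x + 1"
        proof (rule AE_mp, intro AE_I2 impI)
          fix x assume "x \<in> space (lebesgue_on ?B)" "x \<noteq> 0"
          then have x: "0 < norm x" "norm x \<le> 3 * s"
            using z norm_triangle_ineq2[of x z] by (auto simp: dist_norm norm_minus_commute)
          have "ln (norm x) \<le> ln (3 * s)" using x by (intro ln_mono) auto
          moreover have "ln (3 * s) - ln (norm x) \<le> 3 * s / norm x"
            using x s(1) ln_le_minus_one[of "3 * s / norm x"] by (simp add: ln_div)
          ultimately show "norm (log_sol_grad e x - (4 - ln (3 * s)) *\<^sub>R e) \<le> 3 * s / norm x + 1"
            using log_sol_grad_minus_const_le[OF ne, of x "ln (3 * s)"] by simp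
        qed
      qed
      also have "\<dots> = average ?B (\<lambda>x. 3 * s / norm x) + 1"
        using avg(1) integrable_const_lebesgue_on[OF B(1)] by (subst average_add) (auto simp: average_const[OF B])
      also have "\<dots> \<le> K" using avg(2) by (simp add: K_def)
      finally show ?thesis by blast
    qed
    then obtain k where "average ?B (\<lambda>x. norm (log_sol_grad e x - k)) \<le> K" by blast
    with mean_oscillation_le[OF B int, of k] show ?thesis by simp
  qed
  have "bdd_above {average (ball z s) (\<lambda>x. norm (log_sol_grad e x - average (ball z s) (log_sol_grad e))) | z s.
       s > 0 \<and> ball z s \<subseteq> U}"
    using osc by (intro bdd_aboveI[of _ "2 * K"]) blast
  then show ?thesis using integrable_log_sol_grad[OF n e U] by (simp add: BMO_def)
qed

section \<open>Failure of local Lipschitz regularity\<close>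

lemma C1_c_bump:
  fixes \<delta> :: real
  assumes \<delta>: "0 < \<delta>" "cball (0::'a::euclidean_space) \<delta> \<subseteq> U"
  shows "(\<lambda>x::'a. (max 0 (\<delta>\<^sup>2 - (norm x)\<^sup>2))\<^sup>2) \<in> C1_c U"
proof -
  let ?b = "\<lambda>x::'a. (max 0 (\<delta>\<^sup>2 - (norm x)\<^sup>2))\<^sup>2"
  let ?D = "\<lambda>x::'a. (2 * max 0 (\<delta>\<^sup>2 - (norm x)\<^sup>2)) *\<^sub>R (0 - 2 *\<^sub>R x)"
  have D: "GDERIV ?b x :> ?D x" for x
    by (rule GDERIV_DERIV_compose[OF GDERIV_diff[OF GDERIV_const GDERIV_norm_squared] DERIV_max_0_squared])
  have grad: "gradient ?b = ?D" by (rule ext, rule gradient_eqI, rule D)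
  have cont: "continuous_on UNIV (gradient ?b)" unfolding grad by (intro continuous_intros)
  have "?b x = 0" if "x \<notin> cball 0 \<delta>" for x
    using that \<delta> power_mono[of \<delta> "norm x" 2] by simp
  then have "{x. ?b x \<noteq> 0} \<subseteq> cball 0 \<delta>" by blast
  then have sub: "closure {x. ?b x \<noteq> 0} \<subseteq> cball 0 \<delta>" by (rule closure_minimal) simp
  then have comp: "compact (closure {x. ?b x \<noteq> 0})"
    using bounded_subset[OF bounded_cball] by (simp add: compact_eq_bounded_closed)
  have "\<forall>x. \<exists>d. GDERIV ?b x :> d" using D by blast
  then show ?thesis
    unfolding C1_c_def compactly_contained_def mem_Collect_eq
    using cont comp subset_trans[OF sub \<delta>(2)] by (intro conjI)
qed

text \<open>
  If some weak gradient were bounded by \<open>M\<close>, then both it and \<open>log_sol_grad e\<close> would give the same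
  integral against every test function. On a ball so small that the \<open>e\<close> component of \<open>log_sol_grad e\<close> exceeds
  \<open>M + 1\<close>, a nonnegative bump then has nonpositive integral. Testing directly in this way avoids a
  separate proof that weak gradients are unique.
\<close>
lemma log_sol_not_W1_infinity:
  fixes e :: "'a::euclidean_space"
  assumes n: "2 \<le> DIM('a)" and e: "e \<in> Basis" and U: "open U" "U \<subseteq> ball 0 1" "0 \<in> U"
  shows "log_sol e \<notin> W1p \<infinity> U"
proof
  assume "log_sol e \<in> W1p \<infinity> U"
  then obtain G M where G: "has_weak_gradient U (log_sol e) G"
    and meas: "G \<in> borel_measurable (lebesgue_on U)"
    and M: "AE x in lebesgue_on U. norm (G x) \<le> M"
    unfolding W1p_def Lp_def by auto
  have Ul: "U \<in> lmeasurable"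
    using U bounded_subset[OF bounded_ball] by (intro lmeasurable_open) auto
  obtain \<delta>0 where \<delta>0: "0 < \<delta>0" "cball 0 \<delta>0 \<subseteq> U"
    using U open_contains_cball by blast
  \<comment> \<open>Then \<open>4 - ln \<delta> \<ge> M + 2\<close>, and the bounded part of the gradient costs at most \<open>1\<close>.\<close>
  define \<delta> where "\<delta> = min \<delta>0 (exp (2 - M))"
  have \<delta>: "0 < \<delta>" "cball 0 \<delta> \<subseteq> U" "ln \<delta> \<le> 2 - M"
  proof -
    show "0 < \<delta>" "cball 0 \<delta> \<subseteq> U" using \<delta>0 by (auto simp: \<delta>_def)
    then have "ln \<delta> \<le> ln (exp (2 - M))" by (intro ln_mono) (auto simp: \<delta>_def)
    then show "ln \<delta> \<le> 2 - M" by simp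
  qed
  define \<phi> where "\<phi> = (\<lambda>x::'a. (max 0 (\<delta>\<^sup>2 - (norm x)\<^sup>2))\<^sup>2)"
  have \<phi>: "\<phi> \<in> C1_c U" unfolding \<phi>_def using \<delta> by (intro C1_c_bump)
  have \<phi>_pos: "0 < \<phi> x \<longleftrightarrow> x \<in> ball 0 \<delta>" for x
  proof -
    have "0 < \<phi> x \<longleftrightarrow> (norm x)\<^sup>2 < \<delta>\<^sup>2" by (auto simp: \<phi>_def max_def)
    also have "\<dots> \<longleftrightarrow> norm x < \<delta>" 
      using \<delta>(1) power2_less_imp_less[of "norm x" \<delta>] power_strict_mono[of "norm x" \<delta> 2] by auto
    finally show ?thesis by simp
  qed
  have \<phi>_nonneg: "0 \<le> \<phi> x" for x by (simp add: \<phi>_def)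
  obtain B where B: "\<And>x. \<bar>\<phi> x\<bar> \<le> B" using C1_c_bounded[OF \<phi>] by metis
  have mphi: "\<phi> \<in> borel_measurable (lebesgue_on U)"
    by (intro borel_measurable_lebesgue_on borel_measurable_continuous_onI C1_c_continuous[OF \<phi>])
  have "integrable (lebesgue_on U) G"
    by (rule finite_measure.integrable_const_bound[OF finite_measure_lebesgue_on[OF Ul] M meas])
  then have intG: "integrable (lebesgue_on U) (\<lambda>x. \<phi> x *\<^sub>R G x)"
    by (rule integrable_bounded_scaleR[OF mphi B])
  have intL: "integrable (lebesgue_on U) (\<lambda>x. \<phi> x *\<^sub>R log_sol_grad e x)"
    by (rule integrable_bounded_scaleR[OF mphi B integrable_log_sol_grad[OF n e U(1,2)]])
  have "(\<integral>x. \<phi> x *\<^sub>R G x \<partial>lebesgue_on U) = (\<integral>x. \<phi> x *\<^sub>R log_sol_grad e x \<partial>lebesgue_on U)"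
  proof -
    have "(\<integral>x. log_sol e x *\<^sub>R gradient \<phi> x \<partial>lebesgue_on U) = - (\<integral>x. \<phi> x *\<^sub>R G x \<partial>lebesgue_on U)"
      using G \<phi> unfolding has_weak_gradient_def by blast
    moreover have "(\<integral>x. log_sol e x *\<^sub>R gradient \<phi> x \<partial>lebesgue_on U) =
        - (\<integral>x. \<phi> x *\<^sub>R log_sol_grad e x \<partial>lebesgue_on U)"
      using has_weak_gradient_log_sol[OF n e U(1,2)] \<phi> unfolding has_weak_gradient_def by blast
    ultimately show ?thesis by simp
  qed
  then have zero: "(\<integral>x. (\<phi> x *\<^sub>R log_sol_grad e x - \<phi> x *\<^sub>R G x) \<bullet> e \<partial>lebesgue_on U) = 0"
    using intG intL by (subst integral_inner_left) auto
  have int\<phi>: "integrable (lebesgue_on U) \<phi>"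
    using B by (intro finite_measure.integrable_const_bound[OF finite_measure_lebesgue_on[OF Ul] _ mphi, of B]) auto
  have "(\<integral>x. \<phi> x \<partial>lebesgue_on U) \<le> (\<integral>x. (\<phi> x *\<^sub>R log_sol_grad e x - \<phi> x *\<^sub>R G x) \<bullet> e \<partial>lebesgue_on U)"
  proof (rule integral_mono_AE[OF int\<phi>])
    show "integrable (lebesgue_on U) (\<lambda>x. (\<phi> x *\<^sub>R log_sol_grad e x - \<phi> x *\<^sub>R G x) \<bullet> e)"
      using intG intL by (intro integrable_inner_left Bochner_Integration.integrable_diff)
    have "AE x in lebesgue_on U. x \<noteq> 0" using U by (intro AE_nonzero_lebesgue_on) simp
    with M show "AE x in lebesgue_on U. \<phi> x \<le> (\<phi> x *\<^sub>R log_sol_grad e x - \<phi> x *\<^sub>R G x) \<bullet> e"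
    proof eventually_elim
      fix x assume x: "x \<noteq> 0" and M: "norm (G x) \<le> M"
      show "\<phi> x \<le> (\<phi> x *\<^sub>R log_sol_grad e x - \<phi> x *\<^sub>R G x) \<bullet> e"
      proof (cases "0 < \<phi> x")
        case True
        then have "norm x \<le> \<delta>" using \<phi>_pos by simp
        then have "ln (norm x) \<le> ln \<delta>" using x by (intro ln_mono) auto
        then have l: "M + 2 \<le> log_weight x" using \<delta>(3) by (simp add: log_weight_def)
        have ne: "norm e = 1" using e by simp
        have "\<bar>(((x \<bullet> e) / (norm x)\<^sup>2) *\<^sub>R x) \<bullet> e\<bar> \<le> norm (((x \<bullet> e) / (norm x)\<^sup>2) *\<^sub>R x) * norm e"
          by (rule Cauchy_Schwarz_ineq2)
        also have "\<dots> \<le> 1" using norm_inner_ratio_le[OF ne, of x] ne by simp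
        finally have "log_weight x - 1 \<le> log_sol_grad e x \<bullet> e"
          using e by (simp add: log_sol_grad_def inner_diff_left)
        moreover have "G x \<bullet> e \<le> M"
          using Cauchy_Schwarz_ineq2[of "G x" e] M e by simp
        ultimately have "1 \<le> (log_sol_grad e x - G x) \<bullet> e" using l by (simp add: inner_diff_left)
        then have "\<phi> x * 1 \<le> \<phi> x * ((log_sol_grad e x - G x) \<bullet> e)"
          using True by (intro mult_left_mono) auto
        then show ?thesis by (simp add: inner_diff_left algebra_simps)
      next
        case False
        then have "\<phi> x = 0" using \<phi>_nonneg[of x] by simp
        then show ?thesis by simp
      qed
    qed
  qed
  then have "(\<integral>x. \<phi> x \<partial>lebesgue_on U) = 0"
    using zero \<phi>_nonneg by (intro antisym integral_nonneg_AE) auto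
  then have "AE x in lebesgue_on U. \<phi> x = 0"
    using \<phi>_nonneg integral_nonneg_eq_0_iff_AE[OF int\<phi>] by simp
  then have "AE x in lebesgue. x \<in> U \<longrightarrow> \<phi> x = 0"
    using U by (simp add: AE_restrict_space_iff)
  then obtain N where N: "N \<in> null_sets lebesgue"
    "{x \<in> space lebesgue. \<not> (x \<in> U \<longrightarrow> \<phi> x = 0)} \<subseteq> N"
    unfolding eventually_ae_filter by blast
  have "ball 0 \<delta> \<subseteq> N"
  proof
    fix x :: 'a assume x: "x \<in> ball 0 \<delta>"
    then have "x \<in> U" using \<delta>(2) ball_subset_cball by blast
    moreover have "\<phi> x \<noteq> 0" using x \<phi>_pos[of x] by linarith
    ultimately show "x \<in> N" using N(2) by auto
  qed
  moreover have "negligible N" using N(1) by (simp add: negligible_iff_null_sets)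
  ultimately have "negligible (ball (0::'a) \<delta>)" by (meson negligible_subset)
  then show False using \<delta>(1) open_not_negligible[of "ball (0::'a) \<delta>"] by simp
qed

section \<open>The coefficient matrix and the equation\<close>

text \<open>
  At the origin \<open>ln 0 = 0\<close> would give \<open>\<kappa> / 4\<close>; the value \<open>0\<close> is the limit.
\<close>
definition coeff_factor :: "real \<Rightarrow> 'a::real_normed_vector \<Rightarrow> real" where
  "coeff_factor \<kappa> x = (if x = 0 then 0 else \<kappa> / log_weight x)"

text \<open>
  This is \<open>I - c (I - sgn x \<otimes> sgn x)\<close> with \<open>c = coeff_factor \<kappa> x\<close>: the identity on the radial line, and
  \<open>1 - c\<close> times the identity on its orthogonal complement.
\<close>
definition coeff_matrix :: "real \<Rightarrow> real ^ 'n \<Rightarrow> real ^ 'n ^ 'n" where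
  "coeff_matrix \<kappa> x = (\<chi> i j. (if i = j then 1 - coeff_factor \<kappa> x else 0) + coeff_factor \<kappa> x * (sgn x $ i * sgn x $ j))"

lemma log_weight_gt_4:
  assumes "x \<in> ball 0 1" "x \<noteq> 0"
  shows "4 < log_weight x"
proof -
  have "ln (norm x) < 0" using assms by (intro ln_less_zero) auto
  then show ?thesis by (simp add: log_weight_def)
qed

lemma coeff_matrix_mult:
  "coeff_matrix \<kappa> x *v \<xi> = (1 - coeff_factor \<kappa> x) *\<^sub>R \<xi> + (coeff_factor \<kappa> x * (sgn x \<bullet> \<xi>)) *\<^sub>R sgn x"
proof -
  have "(coeff_matrix \<kappa> x *v \<xi>) $ i = ((1 - coeff_factor \<kappa> x) *\<^sub>R \<xi> + (coeff_factor \<kappa> x * (sgn x \<bullet> \<xi>)) *\<^sub>R sgn x) $ i" for i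
  proof -
    have "(coeff_matrix \<kappa> x *v \<xi>) $ i =
      (\<Sum>j\<in>UNIV. (if i = j then (1 - coeff_factor \<kappa> x) * \<xi> $ j else 0) + coeff_factor \<kappa> x * sgn x $ i * (sgn x $ j * \<xi> $ j))"
      unfolding matrix_vector_mult_def coeff_matrix_def
      by (auto intro!: sum.cong simp: algebra_simps)
    also have "\<dots> = (1 - coeff_factor \<kappa> x) * \<xi> $ i + coeff_factor \<kappa> x * sgn x $ i * (sgn x \<bullet> \<xi>)"
      by (simp add: sum.distrib sum_distrib_left[symmetric] inner_vec_def)
    finally show ?thesis by simp
  qed
  then show ?thesis by (simp add: vec_eq_iff)
qed

lemma coeff_factor_bounds:
  assumes "x \<in> ball 0 1" "0 \<le> \<kappa>" "\<kappa> \<le> 2"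
  shows "0 \<le> coeff_factor \<kappa> x" "coeff_factor \<kappa> x \<le> 1 / 2"
proof -
  have "4 < log_weight x" if "x \<noteq> 0"
    using assms(1) that by (rule log_weight_gt_4)
  then show "0 \<le> coeff_factor \<kappa> x" "coeff_factor \<kappa> x \<le> 1 / 2"
    using assms by (auto simp: coeff_factor_def divide_simps)
qed

lemma coeff_factor_tendsto_0: "(coeff_factor \<kappa> \<longlongrightarrow> 0) (at (0::'a::real_normed_vector))"
proof -
  have "filterlim (\<lambda>x::'a. norm x) (at_right 0) (at 0)"
    by (auto simp: filterlim_at eventually_at_filter intro!: tendsto_norm_zero tendsto_ident_at)
  then have "filterlim (\<lambda>x::'a. ln (norm x)) at_bot (at 0)"
    by (rule filterlim_compose[OF ln_at_0])
  then have "filterlim (\<lambda>x::'a. 4 + - ln (norm x)) at_top (at 0)"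
    by (intro filterlim_tendsto_add_at_top[OF tendsto_const]) (simp add: filterlim_uminus_at_top)
  then have "((\<lambda>x::'a. \<kappa> / (4 + - ln (norm x))) \<longlongrightarrow> 0) (at 0)"
    by (rule tendsto_divide_0[OF tendsto_const filterlim_at_top_imp_at_infinity])
  then show ?thesis
    by (rule Lim_transform_eventually) (auto simp: eventually_at_filter coeff_factor_def log_weight_def)
qed

lemma continuous_on_coeff_factor: "continuous_on (ball 0 1) (coeff_factor \<kappa> :: 'a::real_normed_vector \<Rightarrow> real)"
proof (rule continuous_at_imp_continuous_on, rule ballI)
  fix x :: 'a assume x: "x \<in> ball 0 1"
  show "isCont (coeff_factor \<kappa>) x"
  proof (cases "x = 0")
    case True
    then show ?thesis using coeff_factor_tendsto_0[where 'a='a] by (simp add: isCont_def coeff_factor_def)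
  next
    case False
    have "log_weight x \<noteq> 0" using log_weight_gt_4[OF x False] by simp
    then have "isCont (\<lambda>x. \<kappa> / log_weight x) x"
      using False unfolding log_weight_def by (intro continuous_intros) auto
    moreover have "\<forall>\<^sub>F y in nhds x. coeff_factor \<kappa> y = \<kappa> / log_weight y"
      using t1_space_nhds[OF False] by eventually_elim (simp add: coeff_factor_def)
    ultimately show ?thesis by (simp add: isCont_cong)
  qed
qed

text \<open>
  The matrix \<open>sgn x \<otimes> sgn x\<close> has no limit at the origin, but it is bounded and its factor tends to zero
  there.
\<close>
lemma continuous_on_coeff_matrix:
  "continuous_on (ball 0 1) (coeff_matrix \<kappa> :: real ^ 'n \<Rightarrow> real ^ 'n ^ 'n)"
proof -
  have "continuous_on (ball 0 1) (\<lambda>x::real ^ 'n. coeff_factor \<kappa> x * (sgn x $ i * sgn x $ j))" for i j :: 'n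
  proof (rule continuous_at_imp_continuous_on, rule ballI)
    fix x :: "real ^ 'n" assume x: "x \<in> ball 0 1"
    have c: "isCont (coeff_factor \<kappa>) x"
      using continuous_on_coeff_factor[of \<kappa>, where 'a="real ^ 'n"] x
      by (auto simp: continuous_on_eq_continuous_at)
    show "isCont (\<lambda>x. coeff_factor \<kappa> x * (sgn x $ i * sgn x $ j)) x"
    proof (cases "x = 0")
      case True
      have "\<bar>sgn y $ i * sgn y $ j\<bar> \<le> 1" for y :: "real ^ 'n"
      proof -
        have "\<bar>sgn y $ k\<bar> \<le> 1" for k
          using component_le_norm_cart[of "sgn y" k] by (simp add: norm_sgn split: if_splits)
        then have "\<bar>sgn y $ i\<bar> * \<bar>sgn y $ j\<bar> \<le> 1 * 1" by (intro mult_mono) auto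
        then show ?thesis by (simp add: abs_mult)
      qed
      then have "\<bar>coeff_factor \<kappa> y\<bar> * \<bar>sgn y $ i * sgn y $ j\<bar> \<le> \<bar>coeff_factor \<kappa> y\<bar> * 1" for y :: "real ^ 'n"
        by (rule mult_left_mono) simp
      then have "\<forall>\<^sub>F y in at 0. norm (coeff_factor \<kappa> y * (sgn y $ i * sgn y $ j)) \<le> \<bar>coeff_factor \<kappa> y\<bar>"
        by (intro always_eventually allI) (simp add: abs_mult)
      then have "((\<lambda>y::real ^ 'n. coeff_factor \<kappa> y * (sgn y $ i * sgn y $ j)) \<longlongrightarrow> 0) (at 0)"
        using tendsto_rabs_zero[OF coeff_factor_tendsto_0] by (rule Lim_null_comparison)
      then show ?thesis using True by (simp add: isCont_def coeff_factor_def)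
    next
      case False
      then show ?thesis using c by (intro continuous_intros) auto
    qed
  qed
  moreover have "continuous_on (ball 0 1) (\<lambda>x::real ^ 'n. if i = j then 1 - coeff_factor \<kappa> x else 0)" for i j :: 'n
    by (cases "i = j") (auto intro!: continuous_intros continuous_on_coeff_factor)
  ultimately show ?thesis
    unfolding coeff_matrix_def[abs_def] by (intro continuous_on_vec_lambda continuous_on_add)
qed

text \<open>
  The eigenvalues are \<open>1\<close> in the radial direction and \<open>1 - coeff_factor \<kappa> x\<close>, which is at least
  \<open>1/2\<close>, in the tangential ones.
\<close>
lemma elliptic_coeff_matrix:
  assumes \<kappa>: "0 \<le> \<kappa>" "\<kappa> \<le> 2"
  shows "elliptic (ball 0 1) (coeff_matrix \<kappa> :: real ^ 'n \<Rightarrow> real ^ 'n ^ 'n)"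
proof -
  let ?A = "coeff_matrix \<kappa> :: real ^ 'n \<Rightarrow> real ^ 'n ^ 'n"
  have meas: "?A \<in> borel_measurable (lebesgue_on (ball 0 1))"
    using continuous_on_coeff_matrix by (rule continuous_imp_measurable_on_sets_lebesgue) simp
  have sgn1: "norm (sgn x) \<le> 1" for x :: "real ^ 'n" by (simp add: norm_sgn)
  have form: "(?A x *v \<xi>) \<bullet> \<xi> = (norm \<xi>)\<^sup>2 - coeff_factor \<kappa> x * ((norm \<xi>)\<^sup>2 - (sgn x \<bullet> \<xi>)\<^sup>2)" for x \<xi>
    unfolding coeff_matrix_mult power2_norm_eq_inner
    by (simp add: inner_add_left power2_eq_square algebra_simps)
  have cs: "0 \<le> (norm \<xi>)\<^sup>2 - (sgn x \<bullet> \<xi>)\<^sup>2" "(norm \<xi>)\<^sup>2 - (sgn x \<bullet> \<xi>)\<^sup>2 \<le> (norm \<xi>)\<^sup>2" for x \<xi> :: "real ^ 'n"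
  proof -
    have "\<bar>sgn x \<bullet> \<xi>\<bar> \<le> 1 * norm \<xi>"
      using Cauchy_Schwarz_ineq2[of "sgn x" \<xi>] mult_right_mono[OF sgn1[of x] norm_ge_zero[of \<xi>]] by linarith
    then have "\<bar>sgn x \<bullet> \<xi>\<bar>\<^sup>2 \<le> (norm \<xi>)\<^sup>2" by (intro power_mono) auto
    then show "0 \<le> (norm \<xi>)\<^sup>2 - (sgn x \<bullet> \<xi>)\<^sup>2" by simp
  qed simp
  have bounds: "1 / 2 * (norm \<xi>)\<^sup>2 \<le> (?A x *v \<xi>) \<bullet> \<xi>" "(?A x *v \<xi>) \<bullet> \<xi> \<le> 1 * (norm \<xi>)\<^sup>2"
    if x: "x \<in> ball 0 1" for x \<xi>
  proof -
    note c = coeff_factor_bounds[OF x \<kappa>]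
    have "coeff_factor \<kappa> x * ((norm \<xi>)\<^sup>2 - (sgn x \<bullet> \<xi>)\<^sup>2) \<le> 1 / 2 * (norm \<xi>)\<^sup>2"
      using c cs by (intro mult_mono) auto
    then show "1 / 2 * (norm \<xi>)\<^sup>2 \<le> (?A x *v \<xi>) \<bullet> \<xi>" unfolding form by linarith
    show "(?A x *v \<xi>) \<bullet> \<xi> \<le> 1 * (norm \<xi>)\<^sup>2"
      unfolding form using mult_nonneg_nonneg[OF c(1) cs(1)[of \<xi> x]] by linarith
  qed
  have "bounded (?A ` ball 0 1)"
  proof (rule boundedI)
    fix y assume "y \<in> ?A ` ball 0 1"
    then obtain x where x: "x \<in> ball 0 1" and y: "y = ?A x" by blast
    note c = coeff_factor_bounds[OF x \<kappa>]
    have "\<bar>y $ i $ j\<bar> \<le> 2" for i j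
    proof -
      have s: "\<bar>sgn x $ k\<bar> \<le> 1" for k using component_le_norm_cart[of "sgn x" k] sgn1[of x] by linarith
      have "\<bar>coeff_factor \<kappa> x * (sgn x $ i * sgn x $ j)\<bar> \<le> 1 / 2 * (1 * 1)"
        unfolding abs_mult using c s by (intro mult_mono) auto
      moreover have "\<bar>if i = j then 1 - coeff_factor \<kappa> x else 0\<bar> \<le> 1" using c by auto
      moreover have "y $ i $ j = (if i = j then 1 - coeff_factor \<kappa> x else 0) + coeff_factor \<kappa> x * (sgn x $ i * sgn x $ j)"
        by (simp add: y coeff_matrix_def)
      ultimately show ?thesis by linarith
    qed
    then have "norm (y $ i) \<le> (\<Sum>j::'n\<in>UNIV. 2)" for i
      by (intro order_trans[OF norm_le_l1_cart] sum_mono)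
    then have "(\<Sum>i\<in>UNIV. norm (y $ i)) \<le> (\<Sum>i::'n\<in>UNIV. \<Sum>j::'n\<in>UNIV. 2)"
      by (intro sum_mono)
    moreover have "norm y \<le> (\<Sum>i\<in>UNIV. norm (y $ i))"
      unfolding norm_vec_def[of y] by (rule L2_set_le_sum) simp
    ultimately show "norm y \<le> (\<Sum>i::'n\<in>UNIV. \<Sum>j::'n\<in>UNIV. 2)" by (rule order_trans[rotated])
  qed
  moreover have "transpose (?A x) = ?A x" for x
    by (simp add: transpose_def coeff_matrix_def vec_eq_iff mult.commute)
  ultimately show ?thesis
    unfolding elliptic_def using meas bounds
    by (intro conjI ballI exI[of _ "1/2"] exI[of _ 1] allI) auto
qed

text \<open>
  The radial part of the gradient is kept. Its tangential part is \<open>v\<close> times the tangential part of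
  \<open>e\<close>, and the factor \<open>\<kappa> / v\<close> turns the logarithmic coefficient into the constant \<open>\<kappa>\<close>.
\<close>
lemma coeff_matrix_mult_log_sol_grad:
  assumes x: "x \<in> ball 0 1" "x \<noteq> 0"
  shows "coeff_matrix \<kappa> x *v log_sol_grad e x = flux \<kappa> e x"
proof -
  define v where "v = log_weight x"
  define r where "r = norm x"
  have v: "v \<noteq> 0" using log_weight_gt_4[OF x] by (simp add: v_def)
  have r: "r \<noteq> 0" using x by (simp add: r_def)
  define c where "c = coeff_factor \<kappa> x"
  have c: "c * v = \<kappa>" using x v by (simp add: c_def coeff_factor_def v_def)
  have s: "sgn x = (1 / r) *\<^sub>R x" by (simp add: sgn_div_norm r_def divide_inverse)
  have xx: "x \<bullet> x = r * r" by (simp add: r_def power2_norm_eq_inner[symmetric] power2_eq_square)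
  have sg: "sgn x \<bullet> log_sol_grad e x = (v - 1) * (x \<bullet> e) / r"
    using r by (simp add: s log_sol_grad_def inner_diff_right v_def[symmetric] r_def[symmetric] xx power2_eq_square algebra_simps diff_divide_distrib)
  have "coeff_matrix \<kappa> x *v log_sol_grad e x =
      (1 - c) *\<^sub>R (v *\<^sub>R e - ((x \<bullet> e) / r\<^sup>2) *\<^sub>R x) + (c * ((v - 1) * (x \<bullet> e) / r)) *\<^sub>R ((1 / r) *\<^sub>R x)"
    unfolding coeff_matrix_mult sg c_def[symmetric] unfolding s log_sol_grad_def v_def r_def ..
  also have "\<dots> = (v - c * v) *\<^sub>R e + (c * v - 1) *\<^sub>R ((x \<bullet> e) / r\<^sup>2) *\<^sub>R x"
    by (simp add: algebra_simps power2_eq_square diff_divide_distrib add_divide_distrib)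
  also have "\<dots> = flux \<kappa> e x" unfolding c by (simp add: flux_def v_def r_def)
  finally show ?thesis .
qed

theorem proposition1p5:
  assumes "CARD('n::finite) \<ge> 2"
  shows "\<exists>(u :: real ^ 'n \<Rightarrow> real) (Du :: real ^ 'n \<Rightarrow> real ^ 'n) (A :: real ^ 'n \<Rightarrow> real ^ 'n ^ 'n).
           u \<in> W1p_loc 1 (ball 0 1) \<and>
           has_weak_gradient (ball 0 1) u Du \<and>
           elliptic (ball 0 1) A \<and>
           continuous_on (ball 0 1) A \<and>
           weak_solution (ball 0 1) A u \<and>
           (\<forall>p::real. 1 < p \<longrightarrow> u \<in> W1p_loc (ereal p) (ball 0 1)) \<and>
           Du \<in> BMO_loc (ball 0 1) \<and>
           u \<notin> W1p_loc \<infinity> (ball 0 1)"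
proof -
  have n: "2 \<le> DIM(real ^ 'n)" using assms by simp
  obtain e :: "real ^ 'n" where e: "e \<in> Basis" using nonempty_Basis by blast
  define \<kappa> where "\<kappa> = real DIM(real ^ 'n) / (real DIM(real ^ 'n) - 1)"
  have \<kappa>: "0 \<le> \<kappa>" "\<kappa> \<le> 2" using n by (auto simp: \<kappa>_def divide_simps)
  let ?u = "log_sol e" and ?G = "log_sol_grad e" and ?A = "coeff_matrix \<kappa> :: real ^ 'n \<Rightarrow> real ^ 'n ^ 'n"
  have W: "?u \<in> W1p_loc (ereal p) (ball 0 1)" if "0 < p" for p
    unfolding W1p_loc_def compactly_contained_def
    using log_sol_W1p[OF n e _ _ that] closure_subset by blast
  have wg: "has_weak_gradient (ball 0 1) ?u ?G"
    by (intro has_weak_gradient_log_sol n e) auto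
  have "(\<integral>x. (?A x *v ?G x) \<bullet> gradient \<phi> x \<partial>lebesgue_on (ball 0 1)) = 0" if \<phi>: "\<phi> \<in> C1_c (ball 0 1)" for \<phi>
  proof -
    have AE: "AE x in lebesgue_on (ball 0 1 :: (real ^ 'n) set). x \<noteq> 0" by (rule AE_nonzero_lebesgue_on) simp
    have "0 = (\<integral>x. flux \<kappa> e x \<bullet> gradient \<phi> x \<partial>lebesgue_on (ball 0 1))"
      using integral_flux_inner_gradient[OF n e _ _ \<phi> \<kappa>_def] by simp
    also have "\<dots> = (\<integral>x. (?A x *v ?G x) \<bullet> gradient \<phi> x \<partial>lebesgue_on (ball 0 1))"
    proof -
      have eq: "AE x in lebesgue_on (ball 0 1). flux \<kappa> e x \<bullet> gradient \<phi> x = (?A x *v ?G x) \<bullet> gradient \<phi> x"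
        using AE
        by (rule AE_mp) (intro AE_I2 impI, simp add: coeff_matrix_mult_log_sol_grad)
      have mf: "(\<lambda>x. flux \<kappa> e x \<bullet> gradient \<phi> x) \<in> borel_measurable (lebesgue_on (ball 0 1))"
        using C1_c_continuous_gradient[OF \<phi>]
        by (intro borel_measurable_lebesgue_on borel_measurable_inner borel_measurable_log_sol borel_measurable_continuous_onI)
      have mA: "(\<lambda>x. (?A x *v ?G x) \<bullet> gradient \<phi> x) \<in> borel_measurable (lebesgue_on (ball 0 1))"
      proof -
        have "(\<lambda>x. ?A x *v ?G x) \<in> borel_measurable borel"
          unfolding coeff_matrix_mult coeff_factor_def log_weight_def sgn_div_norm
          by measurable
        then show ?thesis
          using C1_c_continuous_gradient[OF \<phi>]
          by (intro borel_measurable_lebesgue_on borel_measurable_inner)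
            (auto intro: borel_measurable_continuous_onI)
      qed
      show ?thesis using mf mA eq by (rule integral_cong_AE)
    qed
    finally show ?thesis by simp
  qed
  then have "weak_solution (ball 0 1) ?A ?u"
    unfolding weak_solution_def using W[of 1] wg by (auto simp: one_ereal_def)
  moreover have "?G \<in> BMO_loc (ball 0 1)"
    unfolding BMO_loc_def compactly_contained_def
    using log_sol_grad_BMO[OF n e open_ball] closure_subset by blast
  moreover have "?u \<notin> W1p_loc \<infinity> (ball 0 1)"
  proof -
    have "compactly_contained (ball (0::real ^ 'n) (1/2)) (ball 0 1)"
      by (auto simp: compactly_contained_def)
    moreover have "?u \<notin> W1p \<infinity> (ball 0 (1/2))"
      by (intro log_sol_not_W1_infinity n e) auto
    ultimately show ?thesis unfolding W1p_loc_def by blast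
  qed
  ultimately show ?thesis
    using W[of 1] W wg elliptic_coeff_matrix[OF \<kappa>] continuous_on_coeff_matrix[of \<kappa>]
    by (intro exI[of _ ?u] exI[of _ ?G] exI[of _ ?A]) (auto simp: one_ereal_def)
qed

end
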